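(* Let $k$ be a field of characteristic zero. There is a bijection between the set of all socle-vectors and the set of all $h$-vectors of standard graded artinian $k$-algebras, given by associating to a socle-vector its minimum $h$-vector.
   Context: Algebras are standard graded artinian $k$-algebras $A=R/I$, with $R=k[x_1,\dots,x_r]$, $k$ a fixed field of characteristic zero, and $I$ a homogeneous ideal containing no non-zero forms of degree 1; $r$ is arbitrary. The $h$-vector of $A$ is $h(A)=(h_0,h_1,\dots,h_e)$, where $h_i=\dim_k A_i$ and $e$ is the last index with $A_e\neq 0$; thus $h_0=1$ and $h_1=r$. It is assumed that $e\ge 1$. The socle of $A$ is $soc(A)=\{a\in A : a\overline{m}=0\}$, where $\overline m=(\overline{x_1},\dots,\overline{x_r})$, and the socle-vector of $A$ is $s(A)=(s_0,s_1,\dots,s_e)$ with $s_i=\dim_k soc(A)_i$; thus $s_0=0$ and $s_e=h_e>0$. "An $h$-vector" (resp. "a socle-vector") means a tuple that is the $h$-vector (resp. socle-vector) of some such algebra. Tuples of integers of the same length are partially ordered entry by entry. The minimum $h$-vector for a socle-vector $s$ is the $h$-vector that is the entry by entry minimum among the $h$-vectors of all such algebras (of any codimension $r$) having socle-vector $s$; part of the assertion is that it exists for every socle-vector $s$. *)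

theory Defs
  imports
    "HOL-Library.Poly_Mapping"
    "HOL-Algebra.QuotRing"
    "HOL-Algebra.Embedded_Algebras"
begin

section \<open>Polynomial rings in finitely many variables\<close>

text \<open>Monomials are exponent vectors; the variables are numbered from 0, so that
  \<open>k[x\<^sub>1,\<dots>,x\<^sub>r]\<close> consists of the polynomials in which only variables with index below \<open>r\<close> occur.\<close>

type_synonym monom = "nat \<Rightarrow>\<^sub>0 nat"
type_synonym 'k mpoly = "monom \<Rightarrow>\<^sub>0 'k"

definition monom_degree :: "monom \<Rightarrow> nat" where
  "monom_degree m = (\<Sum>j\<in>Poly_Mapping.keys m. Poly_Mapping.lookup m j)"

definition poly_carrier :: "nat \<Rightarrow> 'k::field_char_0 mpoly set" where
  "poly_carrier r = {p. \<forall>m\<in>Poly_Mapping.keys p. Poly_Mapping.keys m \<subseteq> {..<r}}"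

definition mpoly_ring :: "nat \<Rightarrow> 'k::field_char_0 mpoly ring" where
  "mpoly_ring r = \<lparr>carrier = poly_carrier r, mult = (*), one = 1, zero = 0, add = (+)\<rparr>"

lemma poly_carrier_add: "p \<in> poly_carrier r \<Longrightarrow> q \<in> poly_carrier r \<Longrightarrow> p + q \<in> poly_carrier r"
  unfolding poly_carrier_def using Poly_Mapping.keys_add[of p q] by auto

lemma poly_carrier_mult: "p \<in> poly_carrier r \<Longrightarrow> q \<in> poly_carrier r \<Longrightarrow> p * q \<in> poly_carrier r"
proof -
  assume p: "p \<in> poly_carrier r" and q: "q \<in> poly_carrier r"
  have "Poly_Mapping.keys m \<subseteq> {..<r}" if "m \<in> Poly_Mapping.keys (p * q)" for m
  proof -
    from that obtain a b where ab: "a \<in> Poly_Mapping.keys p" "b \<in> Poly_Mapping.keys q" "m = a + b"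
      using keys_mult[of p q] by blast
    have "Poly_Mapping.keys a \<subseteq> {..<r}" "Poly_Mapping.keys b \<subseteq> {..<r}"
      using p q ab by (simp_all add: poly_carrier_def)
    then show ?thesis
      using Poly_Mapping.keys_add[of a b] ab(3) by blast
  qed
  then show ?thesis by (simp add: poly_carrier_def)
qed

lemma cring_mpoly_ring: "cring (mpoly_ring r)"
proof (rule cringI)
  show "abelian_group (mpoly_ring r)"
  proof (rule abelian_groupI)
    fix x assume "x \<in> carrier (mpoly_ring r)"
    then have "- x \<in> carrier (mpoly_ring r)" "- x \<oplus>\<^bsub>mpoly_ring r\<^esub> x = \<zero>\<^bsub>mpoly_ring r\<^esub>"
      by (auto simp: mpoly_ring_def poly_carrier_def)
    then show "\<exists>y\<in>carrier (mpoly_ring r). y \<oplus>\<^bsub>mpoly_ring r\<^esub> x = \<zero>\<^bsub>mpoly_ring r\<^esub>" by blast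
  qed (simp_all add: mpoly_ring_def poly_carrier_add add.commute add.left_commute,
       simp add: poly_carrier_def)
  show "comm_monoid (mpoly_ring r)"
    by (rule comm_monoidI)
      (simp_all add: mpoly_ring_def poly_carrier_mult mult.commute mult.left_commute,
       simp add: poly_carrier_def)
qed (simp add: mpoly_ring_def distrib_right)

definition Const :: "'k::field_char_0 \<Rightarrow> 'k mpoly" where
  "Const c = Poly_Mapping.single 0 c"

definition Var :: "nat \<Rightarrow> 'k::field_char_0 mpoly" where
  "Var j = Poly_Mapping.single (Poly_Mapping.single j 1) 1"

text \<open>The space \<open>R\<^sub>d\<close> of forms of degree \<open>d\<close>, zero included.\<close>

definition forms :: "nat \<Rightarrow> nat \<Rightarrow> 'k::field_char_0 mpoly set" where
  "forms r d = {p \<in> poly_carrier r. \<forall>m\<in>Poly_Mapping.keys p. monom_degree m = d}"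

definition hom_component :: "nat \<Rightarrow> 'k::field_char_0 mpoly \<Rightarrow> 'k mpoly" where
  "hom_component d p =
     (\<Sum>m\<in>{m \<in> Poly_Mapping.keys p. monom_degree m = d}.
        Poly_Mapping.single m (Poly_Mapping.lookup p m))"

definition homogeneous_ideal :: "nat \<Rightarrow> 'k::field_char_0 mpoly set \<Rightarrow> bool" where
  "homogeneous_ideal r I \<longleftrightarrow>
     ideal I (mpoly_ring r) \<and> (\<forall>p\<in>I. \<forall>d. hom_component d p \<in> I)"


section \<open>Standard graded artinian algebras\<close>

text \<open>An algebra is given by the number \<open>r\<close> of variables and the ideal \<open>I\<close>.\<close>

definition quot_alg :: "nat \<Rightarrow> 'k::field_char_0 mpoly set \<Rightarrow> 'k mpoly set ring" where
  "quot_alg r I = mpoly_ring r Quot I"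

definition residue :: "nat \<Rightarrow> 'k::field_char_0 mpoly set \<Rightarrow> 'k mpoly \<Rightarrow> 'k mpoly set" where
  "residue r I p = I +>\<^bsub>mpoly_ring r\<^esub> p"

definition scalars :: "nat \<Rightarrow> 'k::field_char_0 mpoly set \<Rightarrow> 'k mpoly set set" where
  "scalars r I = residue r I ` range Const"

lemma subfield_scalars:
  assumes "ideal I (mpoly_ring r)" "I \<noteq> carrier (mpoly_ring r)"
  shows "subfield (scalars r I) (quot_alg r I)"
proof -
  interpret P: cring "mpoly_ring r" by (rule cring_mpoly_ring)
  interpret ideal I "mpoly_ring r" by fact
  interpret Q: cring "quot_alg r I" unfolding quot_alg_def by (rule quotient_is_cring) (rule cring_mpoly_ring)
  have hom: "residue r I \<in> ring_hom (mpoly_ring r) (quot_alg r I)"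
    unfolding residue_def quot_alg_def by (rule rcos_ring_hom)
  have C: "Const c \<in> carrier (mpoly_ring r)" for c :: 'a
    by (auto simp: Const_def mpoly_ring_def poly_carrier_def)
  have one: "residue r I (Const 1) = \<one>\<^bsub>quot_alg r I\<^esub>"
    using ring_hom_one[OF hom] by (simp add: mpoly_ring_def Const_def)
  have mult: "residue r I (Const (a*b)) = residue r I (Const a) \<otimes>\<^bsub>quot_alg r I\<^esub> residue r I (Const b)" for a b :: 'a
    using ring_hom_mult[OF hom C C, of a b] by (simp add: mpoly_ring_def Const_def mult_single)
  have add: "residue r I (Const (a+b)) = residue r I (Const a) \<oplus>\<^bsub>quot_alg r I\<^esub> residue r I (Const b)" for a b :: 'a
    using ring_hom_add[OF hom C C, of a b] by (simp add: mpoly_ring_def Const_def single_add)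
  have cl: "residue r I (Const a) \<in> carrier (quot_alg r I)" for a :: 'a
    using ring_hom_closed[OF hom C] .
  have z: "residue r I (Const 0) = \<zero>\<^bsub>quot_alg r I\<^esub>"
    using add[of 0 0] cl[of 0] Q.add.l_cancel_one' by simp
  have ne: "\<one>\<^bsub>quot_alg r I\<^esub> \<noteq> \<zero>\<^bsub>quot_alg r I\<^esub>"
  proof
    assume "\<one>\<^bsub>quot_alg r I\<^esub> = \<zero>\<^bsub>quot_alg r I\<^esub>"
    then have "\<one>\<^bsub>mpoly_ring r\<^esub> \<in> I" using a_rcos_self[of "\<one>\<^bsub>mpoly_ring r\<^esub>"]
      by (auto simp: quot_alg_def FactRing_def)
    then show False using one_imp_carrier assms by auto
  qed
  show ?thesis
  proof (rule Q.subfieldI)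
    show "subcring (scalars r I) (quot_alg r I)"
    proof (rule Q.subcringI', rule Q.subringI)
      fix h assume "h \<in> scalars r I"
      then obtain a where a: "h = residue r I (Const a)" by (auto simp: scalars_def)
      have "residue r I (Const (-a)) = \<ominus>\<^bsub>quot_alg r I\<^esub> h"
        using add[of "-a" a] a z cl by (metis Q.minus_equality add.left_inverse)
      then show "\<ominus>\<^bsub>quot_alg r I\<^esub> h \<in> scalars r I" unfolding scalars_def by (metis rangeI imageI)
    qed (auto simp: scalars_def cl simp flip: one mult add)
  next
    let ?K = "quot_alg r I \<lparr>carrier := scalars r I\<rparr>"
    show "Units ?K = scalars r I - {\<zero>\<^bsub>quot_alg r I\<^esub>}"
    proof
      show "Units ?K \<subseteq> scalars r I - {\<zero>\<^bsub>quot_alg r I\<^esub>}"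
        using ne cl by (auto simp: Units_def scalars_def)
      show "scalars r I - {\<zero>\<^bsub>quot_alg r I\<^esub>} \<subseteq> Units ?K"
      proof
        fix k assume "k \<in> scalars r I - {\<zero>\<^bsub>quot_alg r I\<^esub>}"
        then obtain a where a: "k = residue r I (Const a)" "a \<noteq> 0"
          using z by (auto simp: scalars_def)
        let ?i = "residue r I (Const (inverse a))"
        have "?i \<otimes>\<^bsub>quot_alg r I\<^esub> k = \<one>\<^bsub>quot_alg r I\<^esub>" "k \<otimes>\<^bsub>quot_alg r I\<^esub> ?i = \<one>\<^bsub>quot_alg r I\<^esub>"
          using a by (simp_all flip: mult one)
        moreover have "k \<in> scalars r I" "?i \<in> scalars r I"
          using a(1) by (auto simp: scalars_def)
        ultimately show "k \<in> Units ?K" by (auto simp: Units_def)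
      qed
    qed
  qed
qed

text \<open>Hence \<^const>\<open>ring.dim\<close> over the scalars is well defined on finite-dimensional subspaces.\<close>

definition alg_dim :: "nat \<Rightarrow> 'k::field_char_0 mpoly set \<Rightarrow> 'k mpoly set set \<Rightarrow> nat" where
  "alg_dim r I V = ring.dim (quot_alg r I) (scalars r I) V"

definition graded_piece :: "nat \<Rightarrow> 'k::field_char_0 mpoly set \<Rightarrow> nat \<Rightarrow> 'k mpoly set set" where
  "graded_piece r I i = residue r I ` forms r i"

definition artinian_ring :: "('a, 'b) ring_scheme \<Rightarrow> bool" where
  "artinian_ring A \<longleftrightarrow>
     ring A \<and>
     (\<forall>J :: nat \<Rightarrow> 'a set. (\<forall>n. ideal (J n) A \<and> J (Suc n) \<subseteq> J n) \<longrightarrow>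
        (\<exists>N. \<forall>n\<ge>N. J n = J N))"

text \<open>The last degree \<open>e\<close> with \<open>A\<^sub>e \<noteq> 0\<close>; such a degree exists for nonzero artinian \<open>A\<close>.\<close>

definition top_degree :: "nat \<Rightarrow> 'k::field_char_0 mpoly set \<Rightarrow> nat" where
  "top_degree r I = (GREATEST i. graded_piece r I i \<noteq> {\<zero>\<^bsub>quot_alg r I\<^esub>})"

text \<open>Properness of \<open>I\<close> only matters for \<open>r = 0\<close>, where the unit ideal contains no nonzero
  linear form; it excludes the zero algebra, for which \<open>h\<^sub>0 = 1\<close> fails and \<open>top_degree\<close> is
  unspecified.\<close>

definition standard_graded_artinian :: "nat \<Rightarrow> 'k::field_char_0 mpoly set \<Rightarrow> bool" where
  "standard_graded_artinian r I \<longleftrightarrow>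
     homogeneous_ideal r I \<and> I \<noteq> carrier (mpoly_ring r) \<and>
     (\<forall>f \<in> I \<inter> forms r 1. f = 0) \<and>
     artinian_ring (quot_alg r I) \<and>
     1 \<le> top_degree r I"

definition max_ideal :: "nat \<Rightarrow> 'k::field_char_0 mpoly set \<Rightarrow> 'k mpoly set set" where
  "max_ideal r I = Idl\<^bsub>quot_alg r I\<^esub> ((\<lambda>j. residue r I (Var j)) ` {..<r})"

definition socle :: "nat \<Rightarrow> 'k::field_char_0 mpoly set \<Rightarrow> 'k mpoly set set" where
  "socle r I = {a \<in> carrier (quot_alg r I).
     \<forall>b\<in>max_ideal r I. a \<otimes>\<^bsub>quot_alg r I\<^esub> b = \<zero>\<^bsub>quot_alg r I\<^esub>}"

definition h_vector :: "nat \<Rightarrow> 'k::field_char_0 mpoly set \<Rightarrow> nat list" where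
  "h_vector r I =
     map (\<lambda>i. alg_dim r I (graded_piece r I i)) [0..<top_degree r I + 1]"

definition socle_vector :: "nat \<Rightarrow> 'k::field_char_0 mpoly set \<Rightarrow> nat list" where
  "socle_vector r I =
     map (\<lambda>i. alg_dim r I (socle r I \<inter> graded_piece r I i)) [0..<top_degree r I + 1]"


section \<open>The sets of vectors over a fixed field\<close>

definition h_vectors :: "'k::field_char_0 itself \<Rightarrow> nat list set" where
  "h_vectors _ = {h_vector r I | r (I :: 'k mpoly set). standard_graded_artinian r I}"

definition socle_vectors :: "'k::field_char_0 itself \<Rightarrow> nat list set" where
  "socle_vectors _ = {socle_vector r I | r (I :: 'k mpoly set). standard_graded_artinian r I}"

definition h_vectors_with_socle :: "'k::field_char_0 itself \<Rightarrow> nat list \<Rightarrow> nat list set" where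
  "h_vectors_with_socle _ s =
     {h_vector r I | r (I :: 'k mpoly set). standard_graded_artinian r I \<and> socle_vector r I = s}"

definition is_min_h_vector :: "'k::field_char_0 itself \<Rightarrow> nat list \<Rightarrow> nat list \<Rightarrow> bool" where
  "is_min_h_vector T s h \<longleftrightarrow>
     h \<in> h_vectors_with_socle T s \<and> (\<forall>h'\<in>h_vectors_with_socle T s. list_all2 (\<le>) h h')"

definition min_h_vector :: "'k::field_char_0 itself \<Rightarrow> nat list \<Rightarrow> nat list" where
  "min_h_vector T s = (THE h. is_min_h_vector T s h)"

end

theory Submission
  imports Defs
begin

text \<open>
  Let \<open>h\<close> and \<open>s\<close> be the \<open>h\<close>-vector and the socle-vector of the same algebra, and let
  \<open>f\<^sub>d n\<close> (\<open>min_shadow d n\<close>) be the least number of monomials of degree \<open>d - 1\<close> that divide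
  some member of a set of \<open>n\<close> monomials of degree \<open>d\<close>. Everything rests on the inequality

    \<open>s\<^sub>i + f\<^bsub>i+1\<^esub> (h\<^bsub>i+1\<^esub>) \<le> h\<^sub>i\<close>,   with equality \<open>s\<^sub>e = h\<^sub>e\<close> in the last degree,

  and on the fact that equality can be attained in all degrees at once.

  The inequality (\<open>socle_plus_shadow_le\<close>): by the usual leading monomial argument, \<open>h\<^sub>d\<close> is the number
  of standard monomials of degree \<open>d\<close>, those that are not leading monomials of forms in \<open>I\<close>. If
  \<open>x\<^sub>j m\<close> is standard, then \<open>m\<close> is not the leading monomial of a form representing a socle element,
  since multiplying such a form by \<open>x\<^sub>j\<close> gives an element of \<open>I\<close>. So \<open>h\<^sub>i - s\<^sub>i\<close> is at least the size of
  the shadow of the \<open>h\<^bsub>i+1\<^esub>\<close> standard monomials of degree \<open>i + 1\<close>.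

  Attaining equality (\<open>realize\<close>): by Macaulay's theorem in its combinatorial form
  (\<open>shadow_initial_minimal\<close>), the minimum \<open>f\<^sub>d n\<close> is attained by the initial segment of size \<open>n\<close> of the
  colexicographic order, and the shadow of an initial segment is again one. Given numbers with
  \<open>f\<^bsub>i+1\<^esub> (h\<^bsub>i+1\<^esub>) \<le> h\<^sub>i\<close>, the initial segments of sizes \<open>h\<^sub>i\<close> therefore form an order ideal of
  monomials; the monomial algebra spanned by it has \<open>h\<close>-vector \<open>h\<close>, and its socle is spanned by the
  monomials outside the shadows, so \<open>s\<^sub>i = h\<^sub>i - f\<^bsub>i+1\<^esub> (h\<^bsub>i+1\<^esub>)\<close>.

  Consequently the recursion \<open>h\<^sub>e = s\<^sub>e\<close>, \<open>h\<^sub>i = s\<^sub>i + f\<^bsub>i+1\<^esub> (h\<^bsub>i+1\<^esub>)\<close> (\<open>least_h\<close>) produces from a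
  socle-vector an \<open>h\<close>-vector which belongs to it, and which is the least one because \<open>f\<^sub>d\<close> is monotone.
  The recursion can be solved for \<open>s\<close>, which gives injectivity; and for every \<open>h\<close>-vector \<open>h\<close> the vector
  \<open>s\<^sub>i = h\<^sub>i - f\<^bsub>i+1\<^esub> (h\<^bsub>i+1\<^esub>)\<close> is a socle-vector with minimum \<open>h\<close>, which gives surjectivity.
\<close>

section \<open>Monomials and shadows\<close>

abbreviation lk :: "monom \<Rightarrow> nat \<Rightarrow> nat" where "lk \<equiv> Poly_Mapping.lookup"
abbreviation X :: "nat \<Rightarrow> monom" where "X j \<equiv> Poly_Mapping.single j 1"

lemma monom_degree_eq_sum:
  assumes "finite A" "Poly_Mapping.keys m \<subseteq> A"
  shows "monom_degree m = (\<Sum>j\<in>A. lk m j)"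
  unfolding monom_degree_def
  by (rule sum.mono_neutral_left) (use assms in \<open>auto simp: in_keys_iff\<close>)

lemma monom_degree_add: "monom_degree (m + n) = monom_degree m + monom_degree n"
proof -
  let ?A = "Poly_Mapping.keys m \<union> Poly_Mapping.keys n"
  have "monom_degree (m + n) = (\<Sum>j\<in>?A. lk (m + n) j)"
    by (rule monom_degree_eq_sum) (use Poly_Mapping.keys_add[of m n] in auto)
  moreover have "monom_degree m = (\<Sum>j\<in>?A. lk m j)" "monom_degree n = (\<Sum>j\<in>?A. lk n j)"
    by (rule monom_degree_eq_sum; auto)+
  ultimately show ?thesis by (simp add: lookup_add sum.distrib)
qed

lemma monom_degree_single [simp]: "monom_degree (Poly_Mapping.single j a) = a"
  by (simp add: monom_degree_def)

lemma monom_degree_zero [simp]: "monom_degree 0 = 0"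
  by (simp add: monom_degree_def)

lemma lookup_le_monom_degree: "lk m j \<le> monom_degree m"
  unfolding monom_degree_def by (cases "j \<in> Poly_Mapping.keys m") (auto intro: member_le_sum simp: in_keys_iff)

lemma monom_degree_eq_0_iff: "monom_degree m = 0 \<longleftrightarrow> m = 0"
proof
  assume "monom_degree m = 0"
  then have "lk m j = 0" for j using lookup_le_monom_degree[of m j] by simp
  then show "m = 0" by (intro poly_mapping_eqI) simp
qed simp

lemma lk_X: "lk (X j) k = (if k = j then 1 else 0)"
    "lk (Poly_Mapping.single j (Suc 0)) k = (if k = j then 1 else 0)"
  by (simp_all add: lookup_single when_def)

lemma X_eq_iff: "X i = X j \<longleftrightarrow> i = j"
proof
  assume "X i = X j"
  then have "Poly_Mapping.keys (X i) = Poly_Mapping.keys (X j)" by simp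
  then show "i = j" by simp
qed simp

lemma minus_X_add: "lk m j > 0 \<Longrightarrow> m - X j + X j = m"
  by (rule poly_mapping_eqI) (auto simp: lookup_add lookup_minus lk_X)

lemma monom_split:
  assumes "m \<noteq> 0" shows "\<exists>m' i. m = m' + X i"
proof -
  obtain i where "lk m i > 0" using assms by (metis gr0I lookup_zero poly_mapping_eqI)
  then show ?thesis using minus_X_add[of m i] by metis
qed

definition monoms :: "nat \<Rightarrow> monom set" where "monoms d = {m. monom_degree m = d}"

definition shadow :: "monom set \<Rightarrow> monom set" where
  "shadow N = {m. \<exists>j. m + X j \<in> N}"

lemma shadowI: "m + X j \<in> N \<Longrightarrow> m \<in> shadow N"
  by (auto simp: shadow_def)

lemma finite_shadow:
  assumes "finite N" shows "finite (shadow N)"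
proof (rule finite_subset)
  show "shadow N \<subseteq> (\<Union>n\<in>N. \<Union>j\<in>Poly_Mapping.keys n. {n - X j})"
  proof
    fix m assume "m \<in> shadow N"
    then obtain j where j: "m + X j \<in> N" by (auto simp: shadow_def)
    moreover have "j \<in> Poly_Mapping.keys (m + X j)" by (simp add: in_keys_iff lookup_add)
    moreover have "m = m + X j - X j" by simp
    ultimately show "m \<in> (\<Union>n\<in>N. \<Union>j\<in>Poly_Mapping.keys n. {n - X j})" by blast
  qed
qed (use assms in auto)

lemma shadow_mono: "A \<subseteq> B \<Longrightarrow> shadow A \<subseteq> shadow B"
  by (auto simp: shadow_def)

lemma shadow_monoms: "N \<subseteq> monoms (Suc d) \<Longrightarrow> shadow N \<subseteq> monoms d"
  by (auto simp: shadow_def monoms_def monom_degree_add subset_iff)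

lemma shadow_monoms_0: "N \<subseteq> monoms 0 \<Longrightarrow> shadow N = {}"
  by (auto simp: shadow_def monoms_def monom_degree_add subset_iff)

section \<open>Compression\<close>

text \<open>
  Shifting a set of monomials towards \<open>x\<^sub>0\<close> must not enlarge its shadow. Moving single exponents does
  not achieve this: the shadow of \<open>x\<^sub>j\<^sup>2\<close> is one monomial, that of \<open>x\<^sub>0 x\<^sub>j\<close> is two. Instead all monomials
  that differ only in the distribution of a total exponent between \<open>x\<^sub>0\<close> and \<open>x\<^sub>j\<close> (a line, with the
  exponent of \<open>x\<^sub>j\<close> as position) are moved simultaneously to the lowest positions of their line.\<close>

definition line :: "nat \<Rightarrow> monom \<Rightarrow> monom set" where
  "line j m = {n. (\<forall>k. k \<noteq> 0 \<longrightarrow> k \<noteq> j \<longrightarrow> lk n k = lk m k) \<and> lk n 0 + lk n j = lk m 0 + lk m j}"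

definition compress :: "nat \<Rightarrow> monom set \<Rightarrow> monom set" where
  "compress j N = {m. lk m j < card (N \<inter> line j m)}"

lemma line_self: "m \<in> line j m" by (simp add: line_def)

lemma line_eq_iff: "line j m = line j n \<longleftrightarrow> n \<in> line j m"
proof
  show "line j m = line j n \<Longrightarrow> n \<in> line j m" using line_self by blast
  show "n \<in> line j m \<Longrightarrow> line j m = line j n" by (auto simp: line_def)
qed

lemma inj_on_line:
  assumes "j \<noteq> 0" shows "inj_on (\<lambda>m. lk m j) (line j m)"
proof (rule inj_onI)
  fix x y assume xy: "x \<in> line j m" "y \<in> line j m" "lk x j = lk y j"
  show "x = y"
  proof (rule poly_mapping_eqI)
    fix k show "lk x k = lk y k"
      using xy by (cases "k = 0"; cases "k = j") (auto simp: line_def)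
  qed
qed

lemma line_position_image:
  assumes "j \<noteq> 0" shows "(\<lambda>m. lk m j) ` line j m = {..lk m 0 + lk m j}"
proof (intro equalityI subsetI)
  fix a assume "a \<in> {..lk m 0 + lk m j}"
  then have "Poly_Mapping.update j a (Poly_Mapping.update 0 (lk m 0 + lk m j - a) m) \<in> line j m"
    using assms by (auto simp: line_def lookup_update)
  then show "a \<in> (\<lambda>m. lk m j) ` line j m"
    by (rule rev_image_eqI) (simp add: lookup_update)
qed (auto simp: line_def)

lemma finite_line: "j \<noteq> 0 \<Longrightarrow> finite (line j m)"
  using finite_imageD[OF _ inj_on_line] line_position_image by (metis finite_atMost)

lemma line_degree: 
  assumes "n \<in> line j m" "j \<noteq> 0" shows "monom_degree n = monom_degree m"
proof -
  let ?A = "insert 0 (insert j (Poly_Mapping.keys m \<union> Poly_Mapping.keys n))"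
  have s: "(\<Sum>k\<in>?A. lk q k) = lk q 0 + lk q j + (\<Sum>k\<in>?A - {0,j}. lk q k)" for q
  proof -
    have "?A = {0,j} \<union> (?A - {0,j})" by auto
    then have "(\<Sum>k\<in>?A. lk q k) = (\<Sum>k\<in>{0,j} \<union> (?A - {0,j}). lk q k)" by simp
    also have "\<dots> = (\<Sum>k\<in>{0,j}. lk q k) + (\<Sum>k\<in>?A - {0,j}. lk q k)"
      by (rule sum.union_disjoint) auto
    finally show ?thesis using assms(2) by simp
  qed
  have "(\<Sum>k\<in>?A - {0,j}. lk n k) = (\<Sum>k\<in>?A - {0,j}. lk m k)"
    by (rule sum.cong) (use assms in \<open>auto simp: line_def\<close>)
  then show ?thesis
    using assms monom_degree_eq_sum[of ?A m] monom_degree_eq_sum[of ?A n]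
    by (simp add: s line_def subset_insertI2)
qed

lemma card_line_le: "j \<noteq> 0 \<Longrightarrow> card (N \<inter> line j m) \<le> Suc (lk m 0 + lk m j)"
  using card_mono[OF finite_line, of j "N \<inter> line j m" m] card_image[OF inj_on_line, of j m]
    line_position_image[of j m] by simp

lemma compress_line_positions:
  assumes "j \<noteq> 0"
  shows "(\<lambda>n. lk n j) ` (compress j N \<inter> line j m) = {..<card (N \<inter> line j m)}"
proof -
  have *: "compress j N \<inter> line j m = {n \<in> line j m. lk n j < card (N \<inter> line j m)}"
  proof -
    have "card (N \<inter> line j n) = card (N \<inter> line j m)" if "n \<in> line j m" for n
      using line_eq_iff[of j m n] that by simp
    then show ?thesis by (auto simp: compress_def)
  qed
  have "(\<lambda>n. lk n j) ` (compress j N \<inter> line j m) = {a \<in> (\<lambda>n. lk n j) ` line j m. a < card (N \<inter> line j m)}"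
    unfolding * by auto
  also have "\<dots> = {..<card (N \<inter> line j m)}"
    unfolding line_position_image[OF assms] using card_line_le[OF assms, of N m] by auto
  finally show ?thesis .
qed

lemma card_compress_line:
  assumes "j \<noteq> 0" shows "card (compress j N \<inter> line j m) = card (N \<inter> line j m)"
  using compress_line_positions[OF assms, of N m]
    card_image[OF inj_on_subset[OF inj_on_line[OF assms]], of "compress j N \<inter> line j m" m] by simp

lemma sum_by_lines:
  fixes w :: "monom \<Rightarrow> nat"
  assumes "finite A" "finite T" "A \<subseteq> T"
  shows "sum w A = (\<Sum>L\<in>line j ` T. sum w (A \<inter> L))"
proof -
  have "sum w A = (\<Sum>L\<in>line j ` T. sum w {x \<in> A. line j x = L})"
    by (rule sum.group[symmetric]) (use assms in auto)
  also have "\<dots> = (\<Sum>L\<in>line j ` T. sum w (A \<inter> L))"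
  proof (rule sum.cong[OF refl])
    fix L assume "L \<in> line j ` T"
    then have "{x \<in> A. line j x = L} = A \<inter> L" using line_eq_iff[of j] by auto
    then show "sum w {x \<in> A. line j x = L} = sum w (A \<inter> L)" by simp
  qed
  finally show ?thesis .
qed

lemma card_le_by_lines:
  assumes "finite A" "finite B" "\<And>m. card (A \<inter> line j m) \<le> card (B \<inter> line j m)"
  shows "card A \<le> card B"
  using sum_by_lines[of A "A \<union> B" "\<lambda>_. 1" j] sum_by_lines[of B "A \<union> B" "\<lambda>_. 1" j] assms
  by (auto intro!: sum_mono)

lemma finite_compress:
  assumes "finite N" "j \<noteq> 0" shows "finite (compress j N)"
proof (rule finite_subset)
  show "compress j N \<subseteq> (\<Union>n\<in>N. line j n)"
  proof
    fix m assume "m \<in> compress j N"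
    then have "N \<inter> line j m \<noteq> {}" by (auto simp: compress_def)
    then show "m \<in> (\<Union>n\<in>N. line j n)" using line_self line_eq_iff[of j m] by blast
  qed
qed (use assms finite_line in auto)

lemma compress_monoms:
  assumes "N \<subseteq> monoms d" "j \<noteq> 0" shows "compress j N \<subseteq> monoms d"
proof
  fix m assume "m \<in> compress j N"
  then have "N \<inter> line j m \<noteq> {}" by (auto simp: compress_def)
  then show "m \<in> monoms d" using assms line_degree[of _ j m] by (auto simp: monoms_def)
qed

lemma card_compress:
  assumes "finite N" "j \<noteq> 0" shows "card (compress j N) = card N"
  using card_le_by_lines[of "compress j N" N j] card_le_by_lines[of N "compress j N" j]
    card_compress_line[OF assms(2)] finite_compress[OF assms] assms(1) by (intro antisym) auto

text \<open>
  The one-dimensional case: positions on a line of length \<open>t + 1\<close>, where position \<open>a\<close> has the two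
  divisors \<open>a\<close> (divide by \<open>x\<^sub>0\<close>) and \<open>a - 1\<close> (divide by \<open>x\<^sub>j\<close>). If some position \<open>c\<close> is missing, keep the
  positions below \<open>c\<close> and lower those above it.\<close>

lemma path_shadow:
  assumes "A \<subseteq> {..t}"
  shows "min (card A) t \<le> card {b. b < t \<and> (b \<in> A \<or> Suc b \<in> A)}" (is "_ \<le> card ?S")
proof (cases "A = {..t}")
  case True
  then have "?S = {..<t}" by auto
  then show ?thesis by simp
next
  case False
  then obtain c where c: "c \<le> t" "c \<notin> A" using assms by auto
  have "card A \<le> card ?S"
  proof (rule card_inj_on_le)
    let ?f = "\<lambda>a. if a < c then a else a - 1"
    have ne: "a \<noteq> c" if "a \<in> A" for a using c that by auto
    show "inj_on ?f A"
    proof (rule inj_onI)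
      fix x y assume "x \<in> A" "y \<in> A" "?f x = ?f y"
      then show "x = y" using ne[of x] ne[of y] by (auto split: if_splits)
    qed
    show "?f ` A \<subseteq> ?S"
    proof
      fix b assume "b \<in> ?f ` A"
      then obtain a where a: "a \<in> A" "b = ?f a" by auto
      then have "a \<le> t" "a \<noteq> c" using assms ne by auto
      then show "b \<in> ?S" using a c by (cases "a < c") auto
    qed
  qed auto
  then show ?thesis by simp
qed

lemma line_shift:
  assumes "j \<noteq> 0" "k \<noteq> 0" "k \<noteq> j" shows "n + X k \<in> line j (m + X k) \<longleftrightarrow> n \<in> line j m"
  using assms by (auto simp: line_def lookup_add lk_X)

text \<open>
  On each line, the shadow of the compressed set occupies an initial stretch of positions. Its last
  position \<open>p\<close> arises from a single division; a division by \<open>x\<^sub>0\<close> or \<open>x\<^sub>j\<close> is handled by the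
  one-dimensional case, and division by another variable maps one line injectively to another.\<close>

lemma shadow_compress_line:
  assumes j: "j \<noteq> 0" and fin: "finite N"
  shows "card (shadow (compress j N) \<inter> line j m) \<le> card (shadow N \<inter> line j m)"
proof (cases "shadow (compress j N) \<inter> line j m = {}")
  case False
  let ?E = "shadow (compress j N) \<inter> line j m"
  have finE: "finite ?E" using finite_line[OF j] by auto
  define p where "p = Max ((\<lambda>n. lk n j) ` ?E)"
  have "p \<in> (\<lambda>n. lk n j) ` ?E" unfolding p_def by (rule Max_in) (use finE False in auto)
  then obtain q where q: "q \<in> ?E" "lk q j = p" by auto
  have "card ?E = card ((\<lambda>n. lk n j) ` ?E)"
    by (rule card_image[symmetric]) (rule inj_on_subset[OF inj_on_line[OF j]], auto)
  also have "\<dots> \<le> card {..p}"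
    by (rule card_mono) (auto simp: p_def finE)
  finally have le: "card ?E \<le> Suc p" by simp
  have Lm: "line j m = line j q" using q line_eq_iff by auto
  define t where "t = lk q 0 + lk q j"
  have pt: "p \<le> t" using q(2) by (simp add: t_def)
  obtain k where k: "q + X k \<in> compress j N" using q by (auto simp: shadow_def)
  have "Suc p \<le> card (shadow N \<inter> line j q)"
  proof (cases "k = 0 \<or> k = j")
    case True
    define L where "L = N \<inter> line j (q + X k)"
    define A where "A = (\<lambda>n. lk n j) ` L"
    have At: "A \<subseteq> {..Suc t}"
      using True j unfolding A_def L_def line_def t_def by (auto simp: lookup_add lk_X)
    have cA: "card A = card L" unfolding A_def
      by (rule card_image) (rule inj_on_subset[OF inj_on_line[OF j]], auto simp: L_def)
    have "lk (q + X k) j < card L" using k by (simp add: compress_def L_def)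
    then have pA: "Suc p \<le> min (card A) (Suc t)" using pt q(2) True by (auto simp: cA lookup_add)
    let ?S = "{b. b < Suc t \<and> (b \<in> A \<or> Suc b \<in> A)}"
    have "?S \<subseteq> (\<lambda>n. lk n j) ` (shadow N \<inter> line j q)"
    proof
      fix b assume b: "b \<in> ?S"
      then have bt: "b \<le> t" by auto
      then obtain n where n: "n \<in> line j q" "lk n j = b"

      proof -
        have "b \<in> (\<lambda>n. lk n j) ` line j q" using bt line_position_image[OF j, of q] by (simp add: t_def)
        then show thesis using that by blast
      qed
      have n0: "lk n 0 = t - b" using n by (auto simp: line_def t_def)
      have "n \<in> shadow N"
      proof (cases "b \<in> A")
        case True
        then obtain l where l: "l \<in> L" "lk l j = b" by (auto simp: A_def)
        have "n + X 0 = l"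
        proof (rule inj_onD[OF inj_on_line[OF j, of "q + X k"]])
          show "n + X 0 \<in> line j (q + X k)" using n \<open>k = 0 \<or> k = j\<close> j
            by (auto simp: line_def lookup_add lk_X)
        qed (use l n j in \<open>auto simp: L_def lookup_add lk_X\<close>)
        then show ?thesis using l by (auto simp: shadow_def L_def)
      next
        case False
        then obtain l where l: "l \<in> L" "lk l j = Suc b" using b by (auto simp: A_def)
        have "n + X j = l"
        proof (rule inj_onD[OF inj_on_line[OF j, of "q + X k"]])
          show "n + X j \<in> line j (q + X k)" using n \<open>k = 0 \<or> k = j\<close> j
            by (auto simp: line_def lookup_add lk_X)
        qed (use l n j in \<open>auto simp: L_def lookup_add lk_X\<close>)
        then show ?thesis using l by (auto simp: shadow_def L_def)
      qed
      then show "b \<in> (\<lambda>n. lk n j) ` (shadow N \<inter> line j q)" using n by blast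
    qed
    then have "card ?S \<le> card (shadow N \<inter> line j q)"
      using finite_line[OF j] by (intro surj_card_le) auto
    then show ?thesis using path_shadow[OF At] pA by linarith
  next
    case False
    have "p < card (N \<inter> line j (q + X k))" using k q False by (simp add: compress_def lookup_add lk_X)
    also have "\<dots> \<le> card (shadow N \<inter> line j q)"
    proof (rule card_inj_on_le)
      have lkn: "lk n k > 0" if "n \<in> line j (q + X k)" for n
        using that False by (auto simp: line_def lookup_add)
      show "inj_on (\<lambda>n. n - X k) (N \<inter> line j (q + X k))"
        by (rule inj_onI) (metis IntD2 lkn minus_X_add)
      show "(\<lambda>n. n - X k) ` (N \<inter> line j (q + X k)) \<subseteq> shadow N \<inter> line j q"
      proof
        fix y assume "y \<in> (\<lambda>n. n - X k) ` (N \<inter> line j (q + X k))"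
        then obtain n where n: "n \<in> N" "n \<in> line j (q + X k)" "y = n - X k" by auto
        then have "y + X k = n" using lkn minus_X_add by blast
        then show "y \<in> shadow N \<inter> line j q"
          using n(1,2) False j line_shift[of j k y q] shadowI[of y k N] by auto
      qed
    qed (use finite_line[OF j] in auto)
    finally show ?thesis by simp
  qed
  then show ?thesis using le Lm by simp
qed simp

lemma card_shadow_compress:
  assumes "j \<noteq> 0" "finite N" shows "card (shadow (compress j N)) \<le> card (shadow N)"
  by (rule card_le_by_lines[OF _ _ shadow_compress_line])
    (use assms finite_shadow finite_compress in auto)

lemma sum_initial_le:
  fixes A :: "nat set" assumes "finite A"
  shows "\<Sum>{..<card A} \<le> \<Sum>A" "A \<noteq> {..<card A} \<Longrightarrow> \<Sum>{..<card A} < \<Sum>A"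
proof -
  let ?I = "{..<card A}"
  have c: "card (A - ?I) = card (?I - A)"
    using card_le_sym_Diff[of A ?I] card_le_sym_Diff[of ?I A] assms by simp
  have 1: "\<Sum>A = \<Sum>(A \<inter> ?I) + \<Sum>(A - ?I)" using assms by (rule sum.Int_Diff)
  have 2: "\<Sum>?I = \<Sum>(A \<inter> ?I) + \<Sum>(?I - A)"
    using sum.Int_Diff[of ?I "\<lambda>x. x" A] by (simp add: Int_commute)
  have 3: "card (A - ?I) * card A \<le> \<Sum>(A - ?I)"
    using sum_bounded_below[of "A - ?I" "card A" "\<lambda>x. x"] by auto
  have 4: "\<Sum>(?I - A) \<le> card (?I - A) * card A"
    using sum_bounded_above[of "?I - A" "\<lambda>x. x" "card A"] by auto
  show "\<Sum>?I \<le> \<Sum>A" using 1 2 3 4 c by simp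
  assume "A \<noteq> ?I"
  then have "?I - A \<noteq> {}" 
    using card_subset_eq[OF assms, of ?I] by auto
  then have "\<Sum>(?I - A) < card (?I - A) * card A"
    using sum_bounded_above_strict[of "?I - A" "\<lambda>x. x" "card A"] by (auto simp: card_gt_0_iff)
  then show "\<Sum>?I < \<Sum>A" using 1 2 3 c by simp
qed

text \<open>
  Stability with respect to the single target variable \<open>x\<^sub>0\<close> suffices for the induction below; it
  makes the shadow of \<open>N\<close> the set of quotients by \<open>x\<^sub>0\<close> of members of \<open>N\<close>.\<close>

definition x0_stable :: "monom set \<Rightarrow> bool" where
  "x0_stable N \<longleftrightarrow> (\<forall>m j. m + X j \<in> N \<longrightarrow> m + X 0 \<in> N)"

text \<open>
  The sum of the exponents of \<open>x\<^sub>0\<close> serves as the termination measure for repeated compression.\<close>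

lemma compress_increases:
  assumes N: "finite N" and m: "m + X j \<in> N" "m + X 0 \<notin> N"
  shows "sum (\<lambda>n. lk n 0) N < sum (\<lambda>n. lk n 0) (compress j N)"
proof -
  have j: "j \<noteq> 0" using m by (intro notI) simp
  let ?T = "N \<union> compress j N"
  have finT: "finite ?T" using N finite_compress[OF N j] by auto
  have line_sum: "sum (\<lambda>n. lk n 0) A + \<Sum>((\<lambda>n. lk n j) ` A) = card A * (lk q 0 + lk q j)"
    if "A \<subseteq> line j q" for A q
  proof -
    have "\<Sum>((\<lambda>n. lk n j) ` A) = sum (\<lambda>n. lk n j) A"
      using sum.reindex[OF inj_on_subset[OF inj_on_line[OF j] that], of "\<lambda>x. x"] by (simp add: comp_def)
    then have "sum (\<lambda>n. lk n 0) A + \<Sum>((\<lambda>n. lk n j) ` A) = (\<Sum>n\<in>A. lk n 0 + lk n j)"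
      by (simp add: sum.distrib)
    also have "\<dots> = (\<Sum>n\<in>A. lk q 0 + lk q j)" by (rule sum.cong) (use that in \<open>auto simp: line_def\<close>)
    finally show ?thesis by simp
  qed
  define pos where "pos q = (\<lambda>n. lk n j) ` (N \<inter> line j q)" for q
  have cpos: "card (pos q) = card (N \<inter> line j q)" for q
    unfolding pos_def by (rule card_image) (rule inj_on_subset[OF inj_on_line[OF j]], auto)
  have finpos: "finite (pos q)" for q unfolding pos_def using N by auto
  have e: "sum (\<lambda>n. lk n 0) (N \<inter> line j q) + \<Sum>(pos q)
      = sum (\<lambda>n. lk n 0) (compress j N \<inter> line j q) + \<Sum>{..<card (pos q)}" for q
    using line_sum[of "N \<inter> line j q" q, OF Int_lower2] line_sum[of "compress j N \<inter> line j q" q, OF Int_lower2]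
    unfolding compress_line_positions[OF j] card_compress_line[OF j] pos_def[symmetric] cpos by linarith
  have le: "sum (\<lambda>n. lk n 0) (N \<inter> line j q) \<le> sum (\<lambda>n. lk n 0) (compress j N \<inter> line j q)" for q
    using e[of q] sum_initial_le(1)[OF finpos, of q] by linarith
  let ?q = "m + X j"
  have "lk (m + X j) j \<in> pos ?q" using m line_self unfolding pos_def by blast
  moreover have "lk m j \<notin> pos ?q"
  proof
    assume "lk m j \<in> pos ?q"
    then obtain n where n: "n \<in> N" "n \<in> line j ?q" "lk n j = lk m j" by (auto simp: pos_def)
    have "n = m + X 0"
      by (rule inj_onD[OF inj_on_line[OF j, of ?q]]) (use n j in \<open>auto simp: line_def lookup_add lk_X\<close>)
    then show False using n m by simp
  qed
  moreover have "lk m j < lk ?q j" by (simp add: lookup_add)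
  ultimately have "pos ?q \<noteq> {..<card (pos ?q)}"
    by (metis lessThan_iff less_trans)
  then have lt: "sum (\<lambda>n. lk n 0) (N \<inter> line j ?q) < sum (\<lambda>n. lk n 0) (compress j N \<inter> line j ?q)"
    using e[of ?q] sum_initial_le(2)[OF finpos, of ?q] by linarith
  have "sum (\<lambda>n. lk n 0) N = (\<Sum>L\<in>line j ` ?T. sum (\<lambda>n. lk n 0) (N \<inter> L))"
    by (rule sum_by_lines) (use finT in auto)
  also have "\<dots> < (\<Sum>L\<in>line j ` ?T. sum (\<lambda>n. lk n 0) (compress j N \<inter> L))"
  proof (rule sum_strict_mono_ex1)
    show "finite (line j ` ?T)" using finT by simp
    show "\<forall>L\<in>line j ` ?T. sum (\<lambda>n. lk n 0) (N \<inter> L) \<le> sum (\<lambda>n. lk n 0) (compress j N \<inter> L)"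
      using le by blast
    show "\<exists>L\<in>line j ` ?T. sum (\<lambda>n. lk n 0) (N \<inter> L) < sum (\<lambda>n. lk n 0) (compress j N \<inter> L)"
      using lt m(1) by blast
  qed
  also have "\<dots> = sum (\<lambda>n. lk n 0) (compress j N)"
    by (rule sum_by_lines[symmetric]) (use finT in auto)
  finally show ?thesis .
qed

lemma exists_stable:
  assumes "finite N" "N \<subseteq> monoms d"
  shows "\<exists>N'. finite N' \<and> N' \<subseteq> monoms d \<and> card N' = card N \<and> card (shadow N') \<le> card (shadow N) \<and> x0_stable N'"
  using assms
proof (induction "card N * d - sum (\<lambda>n. lk n 0) N" arbitrary: N rule: less_induct)
  case less
  show ?case
  proof (cases "x0_stable N")
    case False
    then obtain m j where m: "m + X j \<in> N" "m + X 0 \<notin> N" by (auto simp: x0_stable_def)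
    then have j: "j \<noteq> 0" by (intro notI) simp
    let ?C = "compress j N"
    have c: "card ?C = card N" by (rule card_compress) (use less j in auto)
    have sub: "?C \<subseteq> monoms d" by (rule compress_monoms) (use less j in auto)
    have "sum (\<lambda>n. lk n 0) ?C \<le> card ?C * d"
      using sum_bounded_above[of ?C "\<lambda>n. lk n 0" d] sub lookup_le_monom_degree by (auto simp: monoms_def)
    then have "card ?C * d - sum (\<lambda>n. lk n 0) ?C < card N * d - sum (\<lambda>n. lk n 0) N"
      using compress_increases[OF less(2) m] c by simp
    from less(1)[OF this finite_compress[OF less(2) j] sub]
    obtain N' where "finite N'" "N' \<subseteq> monoms d" "card N' = card ?C" "card (shadow N') \<le> card (shadow ?C)" "x0_stable N'"
      by blast
    then show ?thesis using c card_shadow_compress[OF j less(2)] by (intro exI[of _ N']) auto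
  qed (use less in blast)
qed

section \<open>The colexicographic order and its initial segments\<close>

text \<open>
  The order in which the highest variable decides. Within a fixed degree every monomial has only
  finitely many predecessors, so the initial segments do not depend on a number of variables.\<close>

definition colex :: "monom \<Rightarrow> monom \<Rightarrow> bool" (infix "\<prec>" 50) where
  "m \<prec> n \<longleftrightarrow> (\<exists>k. lk m k < lk n k \<and> (\<forall>l>k. lk m l = lk n l))"

lemma colex_irrefl: "\<not> m \<prec> m" by (auto simp: colex_def)

lemma colex_trans: assumes "m \<prec> n" "n \<prec> p" shows "m \<prec> p"
proof -
  obtain k where k: "lk m k < lk n k" "\<forall>l>k. lk m l = lk n l" using assms by (auto simp: colex_def)
  obtain k' where k': "lk n k' < lk p k'" "\<forall>l>k'. lk n l = lk p l" using assms by (auto simp: colex_def)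
  have "lk m (max k k') < lk p (max k k') \<and> (\<forall>l>max k k'. lk m l = lk p l)"
    using k k' by (cases k k' rule: linorder_cases) auto
  then show ?thesis unfolding colex_def by blast
qed

lemma colex_asym: "m \<prec> n \<Longrightarrow> \<not> n \<prec> m"
  using colex_trans colex_irrefl by blast

lemma colex_total: assumes "m \<noteq> n" shows "m \<prec> n \<or> n \<prec> m"
proof -
  let ?D = "{k. lk m k \<noteq> lk n k}"
  have fin: "finite ?D"
    by (rule finite_subset[of _ "Poly_Mapping.keys m \<union> Poly_Mapping.keys n"]) (auto simp: in_keys_iff)
  have ne: "?D \<noteq> {}" using assms by (auto intro: poly_mapping_eqI)
  define k where "k = Max ?D"
  have k: "lk m k \<noteq> lk n k" using Max_in[OF fin ne] by (simp add: k_def)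
  have "lk m l = lk n l" if "l > k" for l
    using Max_ge[OF fin, of l] that unfolding k_def by fastforce
  then show ?thesis unfolding colex_def using k by (metis linorder_neqE_nat)
qed

lemma colex_add_iff: "m + p \<prec> n + p \<longleftrightarrow> m \<prec> n"
  by (simp add: colex_def lookup_add)

lemma colex_X: assumes "i < j" shows "m + X i \<prec> m + X j"
proof -
  have "lk (m + X i) j < lk (m + X j) j \<and> (\<forall>l>j. lk (m + X i) l = lk (m + X j) l)"
    using assms by (auto simp: lookup_add lk_X)
  then show ?thesis unfolding colex_def by blast
qed

lemma finite_bounded_monoms: "finite {m. Poly_Mapping.keys m \<subseteq> {..<r} \<and> monom_degree m = d}" (is "finite ?A")
proof (rule finite_imageD)
  let ?f = "\<lambda>m. restrict (lk m) {..<r}"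
  have "?f ` ?A \<subseteq> PiE {..<r} (\<lambda>_. {..d})" 
    by (intro image_subsetI PiE_I) (auto simp: lookup_le_monom_degree)
  then show "finite (?f ` ?A)" by (rule finite_subset) (auto intro: finite_PiE)
  show "inj_on ?f ?A"
  proof (rule inj_onI)
    fix m n assume mn: "m \<in> ?A" "n \<in> ?A" "?f m = ?f n"
    show "m = n"
    proof (rule poly_mapping_eqI)
      fix k show "lk m k = lk n k"
      proof (cases "k < r")
        case True
        then show ?thesis using fun_cong[OF mn(3), of k] by simp
      next
        case False
        then have "k \<notin> Poly_Mapping.keys m" "k \<notin> Poly_Mapping.keys n" using mn by auto
        then show ?thesis by (simp add: in_keys_iff)
      qed
    qed
  qed
qed

lemma finite_colex_below: "finite {n \<in> monoms d. n \<prec> m}"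
proof -
  obtain K where K: "Poly_Mapping.keys m \<subseteq> {..<K}"
    using finite_nat_iff_bounded[of "Poly_Mapping.keys m"] by auto
  have KK: "k < K" if "lk m k \<noteq> 0" for k
    using K that unfolding in_keys_iff[symmetric] by blast
  have "Poly_Mapping.keys n \<subseteq> {..<K}" if nm: "n \<prec> m" for n
  proof
    fix l assume "l \<in> Poly_Mapping.keys n"
    then have l: "lk n l \<noteq> 0" by (simp add: in_keys_iff)
    obtain k where k: "lk n k < lk m k" "\<forall>l>k. lk n l = lk m l" using nm by (auto simp: colex_def)
    then have "k < K" by (intro KK) simp
    moreover have "l < K" if "l > k" using k l that by (intro KK) simp
    ultimately show "l \<in> {..<K}" by (cases "l > k") auto
  qed
  then show ?thesis
    by (intro finite_subset[OF _ finite_bounded_monoms[of K d]]) (auto simp: monoms_def)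
qed

lemma asymp_on_colex: "asymp_on A (\<prec>)" using colex_asym by (auto intro: asymp_onI)
lemma transp_on_colex: "transp_on A (\<prec>)" using colex_trans by (auto intro: transp_onI)

lemma colex_least:
  assumes "Q \<subseteq> monoms d" "Q \<noteq> {}"
  shows "\<exists>w\<in>Q. \<forall>n\<in>Q. \<not> n \<prec> w"
proof -
  obtain y where y: "y \<in> Q" using assms by auto
  let ?B = "{n \<in> Q. n = y \<or> n \<prec> y}"
  have "finite ({n \<in> monoms d. n \<prec> y} \<union> {y})" using finite_colex_below by simp
  then have "finite ?B" by (rule finite_subset[rotated]) (use assms in auto)
  moreover have "?B \<noteq> {}" using y by auto
  ultimately obtain w where w: "w \<in> ?B" "\<forall>n\<in>?B. n \<noteq> w \<longrightarrow> \<not> n \<prec> w"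
    using Finite_Set.bex_min_element[OF _ asymp_on_colex transp_on_colex, of ?B] by blast
  have "\<not> n \<prec> w" if "n \<in> Q" for n
  proof
    assume n: "n \<prec> w"
    then have "n \<in> ?B" using w(1) that colex_trans by auto
    moreover have "n \<noteq> w" using n colex_irrefl by metis
    ultimately show False using w(2) n by blast
  qed
  then show ?thesis using w(1) by blast
qed

definition initial :: "nat \<Rightarrow> monom set \<Rightarrow> bool" where
  "initial d C \<longleftrightarrow> C \<subseteq> monoms d \<and> finite C \<and> (\<forall>m\<in>C. \<forall>n\<in>monoms d. n \<prec> m \<longrightarrow> n \<in> C)"

lemma initialD: "initial d C \<Longrightarrow> m \<in> C \<Longrightarrow> n \<prec> m \<Longrightarrow> monom_degree n = d \<Longrightarrow> n \<in> C"
  by (auto simp: initial_def monoms_def)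

lemma initial_degree: assumes "initial d C" "m \<in> C" shows "monom_degree m = d"
  using assms unfolding initial_def monoms_def by blast

lemma initial_finite: "initial d C \<Longrightarrow> finite C"
  by (simp add: initial_def)

lemma initial_subset_or:
  assumes "initial d C" "initial d D" shows "C \<subseteq> D \<or> D \<subseteq> C"
proof (rule ccontr)
  assume "\<not> ?thesis"
  then obtain m n where "m \<in> C" "m \<notin> D" "n \<in> D" "n \<notin> C" by blast
  then show False using assms colex_total[of m n] unfolding initial_def by blast
qed

lemma initial_subset:
  assumes "initial d C" "initial d D" "card C \<le> card D" shows "C \<subseteq> D"
  using initial_subset_or[OF assms(1,2)]
proof
  assume "D \<subseteq> C"
  then have "D = C" using assms by (intro card_seteq) (auto simp: initial_def)
  then show ?thesis by simp
qed

lemma initial_remove_max: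
  assumes "initial d C" "C \<noteq> {}"
  shows "\<exists>l\<in>C. initial d (C - {l}) \<and> (\<forall>m\<in>C. m \<noteq> l \<longrightarrow> m \<prec> l)"
proof -
  have "finite C" using assms by (simp add: initial_def)
  then obtain l where l: "l \<in> C" "\<forall>m\<in>C. m \<noteq> l \<longrightarrow> \<not> l \<prec> m"
    using Finite_Set.bex_max_element[OF _ asymp_on_colex transp_on_colex, of C] assms(2) by blast
  then have "\<forall>m\<in>C. m \<noteq> l \<longrightarrow> m \<prec> l" using colex_total by blast
  moreover have "initial d (C - {l})"
    using assms(1) l colex_irrefl unfolding initial_def by blast
  ultimately show ?thesis using l by blast
qed

lemma initial_truncate:
  assumes "initial d D" "k \<le> card D"
  shows "\<exists>E\<subseteq>D. initial d E \<and> card E = k"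
  using assms
proof (induction "card D" arbitrary: D rule: less_induct)
  case less
  show ?case
  proof (cases "k = card D")
    case False
    then have "D \<noteq> {}" using less by auto
    then obtain l where l: "l \<in> D" "initial d (D - {l})" using initial_remove_max[OF less(2)] by blast
    have finD: "finite D" using less(2) by (simp add: initial_def)
    have c: "card (D - {l}) = card D - 1" "card D > 0"
      using l(1) finD by (simp, metis card_gt_0_iff empty_iff)
    then have "\<exists>E\<subseteq>D - {l}. initial d E \<and> card E = k"
      using less(1)[OF _ l(2)] less(3) False by simp
    then show ?thesis by blast
  qed (use less in blast)
qed

lemma exists_pure_power:
  fixes C :: "monom set"
  assumes "finite C" "d > 0"
  shows "\<exists>k>0. Poly_Mapping.single k d \<notin> C"
proof (rule ccontr)
  assume "\<not> ?thesis"
  then have "\<forall>k>0. Poly_Mapping.single k d \<in> C" by blast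
  then have "(\<lambda>k::nat. Poly_Mapping.single k d) ` {0<..} \<subseteq> C" by (simp add: image_subset_iff)
  then have "finite ((\<lambda>k::nat. Poly_Mapping.single k d) ` {0<..})" by (rule finite_subset[OF _ assms(1)])
  moreover have "inj_on (\<lambda>k::nat. Poly_Mapping.single k d) {0<..}"
  proof (rule inj_onI)
    fix k l :: nat assume "Poly_Mapping.single k d = Poly_Mapping.single l d"
    then have "Poly_Mapping.keys (Poly_Mapping.single k d) = Poly_Mapping.keys (Poly_Mapping.single l d)"
      by simp
    then show "k = l" using assms(2) by simp
  qed
  ultimately have "finite {0::nat<..}" by (rule finite_imageD)
  then show False by (simp add: infinite_Ioi)
qed

lemma exists_initial:
  assumes "d > 0" shows "\<exists>C. initial d C \<and> card C = n"
proof (induction n)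
  case 0
  have "initial d {}" by (simp add: initial_def)
  then show ?case by (metis card.empty)
next
  case (Suc n)
  then obtain C where C: "initial d C" "card C = n" by blast
  then have fin: "finite C" by (simp add: initial_def)
  let ?Q = "monoms d - C"
  obtain k where "Poly_Mapping.single k d \<notin> C" using exists_pure_power[OF fin assms] by blast
  then have "Poly_Mapping.single k d \<in> ?Q" by (simp add: monoms_def)
  then have "?Q \<noteq> {}" by blast
  then obtain w where w: "w \<in> ?Q" "\<forall>n\<in>?Q. \<not> n \<prec> w" using colex_least[of ?Q d] by blast
  have "initial d (insert w C)" using C(1) w unfolding initial_def by blast
  moreover have "card (insert w C) = Suc n" using w fin C by simp
  ultimately show ?case by blast
qed


lemma initial_stable: assumes "initial d C" shows "x0_stable C"
  unfolding x0_stable_def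
proof (intro allI impI)
  fix m j assume a: "m + X j \<in> C"
  then have "monom_degree (m + X 0) = d"
    using initial_degree[OF assms a] by (simp add: monom_degree_add)
  then show "m + X 0 \<in> C" using a colex_X[of 0 j m] initialD[OF assms a] by (cases "j = 0") auto
qed

lemma stable_shadow_eq: "x0_stable N \<Longrightarrow> shadow N = {m. m + X 0 \<in> N}"
  by (auto simp: x0_stable_def shadow_def)

lemma stable_shadow: "x0_stable N \<Longrightarrow> x0_stable (shadow N)"
proof -
  assume st: "x0_stable N"
  have "m + X 0 + X 0 \<in> N" if "m + X j + X 0 \<in> N" for m j
    using st[unfolded x0_stable_def, rule_format, of "m + X 0" j] that
    by (simp only: ac_simps)
  then show ?thesis unfolding stable_shadow_eq[OF st] by (simp add: x0_stable_def)
qed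

lemma initial_shadow:
  assumes "initial (Suc d) C" shows "initial d (shadow C)"
  unfolding initial_def
proof (intro conjI ballI impI)
  show "shadow C \<subseteq> monoms d" "finite (shadow C)"
    using assms shadow_monoms[of C d] finite_shadow[of C] by (simp_all add: initial_def)
  fix m n assume "m \<in> shadow C" "n \<in> monoms d" "n \<prec> m"
  then show "n \<in> shadow C"
    using initialD[OF assms, of "m + X 0" "n + X 0"] stable_shadow_eq[OF initial_stable[OF assms]]
    by (simp add: colex_add_iff monoms_def monom_degree_add)
qed

abbreviation zfree :: "monom set \<Rightarrow> monom set" where "zfree A \<equiv> {m \<in> A. lk m 0 = 0}"

text \<open>
  Multiplication by \<open>x\<^sub>0\<close> is a bijection from the shadow onto the members divisible by \<open>x\<^sub>0\<close>.\<close>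

lemma card_shadow_stable:
  assumes "x0_stable N" "finite N" shows "card (shadow N) + card (zfree N) = card N"
proof -
  have "bij_betw (\<lambda>m. m + X 0) (shadow N) (N - zfree N)"
    unfolding stable_shadow_eq[OF assms(1)]
  proof (rule bij_betwI[where g = "\<lambda>m. m - X 0"])
    show "(\<lambda>m. m - X 0) \<in> N - zfree N \<rightarrow> {m. m + X 0 \<in> N}"
      using minus_X_add[of _ 0] by fastforce
    show "m - X 0 + X 0 = m" if "m \<in> N - zfree N" for m using minus_X_add[of m 0] that by auto
  qed (auto simp: lookup_add)
  then have "card (shadow N) = card (N - zfree N)" by (rule bij_betw_same_card)
  moreover have "card (zfree N) \<le> card N" by (rule card_mono) (use assms in auto)
  ultimately show ?thesis using assms card_Diff_subset[of "zfree N" N] by auto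
qed

text \<open>
  Renaming \<open>x\<^bsub>k+1\<^esub>\<close> to \<open>x\<^sub>k\<close>. On monomials free of \<open>x\<^sub>0\<close> this is an isomorphism for degree, order and
  shadow, which lets the induction treat the part of a set that is free of \<open>x\<^sub>0\<close>.\<close>

definition down :: "monom \<Rightarrow> monom" where "down m = Poly_Mapping.map_key Suc m"

lemma lk_down [simp]: "lk (down m) k = lk m (Suc k)"
  by (simp add: down_def map_key.rep_eq)

lemma down_inj: assumes "down m = down n" "lk m 0 = lk n 0" shows "m = n"
proof (rule poly_mapping_eqI)
  fix k show "lk m k = lk n k"
    using assms by (cases k) (auto simp flip: lk_down)
qed

lemma down_surj: "\<exists>u. lk u 0 = 0 \<and> down u = n"
proof -
  let ?f = "\<lambda>k. if k = 0 then 0 else lk n (k - 1)"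
  have "{k. ?f k \<noteq> 0} \<subseteq> Suc ` Poly_Mapping.keys n"
  proof
    fix k assume "k \<in> {k. ?f k \<noteq> 0}"
    then show "k \<in> Suc ` Poly_Mapping.keys n"
      by (cases k) (auto simp: in_keys_iff)
  qed
  then have "finite {k. ?f k \<noteq> 0}" by (rule finite_subset) auto
  then have "lk (Abs_poly_mapping ?f) = ?f" by (rule lookup_Abs_poly_mapping)
  then have "lk (Abs_poly_mapping ?f) 0 = 0 \<and> down (Abs_poly_mapping ?f) = n"
    by (auto intro!: poly_mapping_eqI)
  then show ?thesis by blast
qed

lemma degree_down: assumes "lk m 0 = 0" shows "monom_degree (down m) = monom_degree m"
proof -
  have "Poly_Mapping.keys m \<subseteq> Suc ` Poly_Mapping.keys (down m)"
  proof
    fix k assume "k \<in> Poly_Mapping.keys m"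
    then show "k \<in> Suc ` Poly_Mapping.keys (down m)"
      using assms by (cases k) (auto simp: in_keys_iff)
  qed
  then have "monom_degree m = (\<Sum>k\<in>Suc ` Poly_Mapping.keys (down m). lk m k)"
    by (intro monom_degree_eq_sum) auto
  then show ?thesis by (simp add: sum.reindex monom_degree_def)
qed

lemma colex_down: assumes "lk m 0 = lk n 0" shows "down m \<prec> down n \<longleftrightarrow> m \<prec> n"
proof
  assume "down m \<prec> down n"
  then obtain k where k: "lk m (Suc k) < lk n (Suc k)" "\<forall>l>k. lk m (Suc l) = lk n (Suc l)"
    by (auto simp: colex_def)
  have "lk m l = lk n l" if "l > Suc k" for l using k that by (cases l) auto
  then show "m \<prec> n" using k unfolding colex_def by blast
next
  assume "m \<prec> n"
  then obtain k where k: "lk m k < lk n k" "\<forall>l>k. lk m l = lk n l" by (auto simp: colex_def)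
  then obtain i where "k = Suc i" using assms by (cases k) auto
  then show "down m \<prec> down n" using k unfolding colex_def by auto
qed

lemma shadow_down:
  assumes "\<And>m. m \<in> A \<Longrightarrow> lk m 0 = 0" shows "shadow (down ` A) = down ` shadow A"
proof (intro equalityI subsetI)
  fix n assume "n \<in> shadow (down ` A)"
  then obtain k a where a: "a \<in> A" "n + X k = down a" by (auto simp: shadow_def)
  have p: "lk a (Suc k) > 0"
    using arg_cong[OF a(2), of "\<lambda>q. lk q k"] by (simp add: lookup_add)
  let ?b = "a - X (Suc k)"
  have "?b + X (Suc k) = a" by (rule minus_X_add[OF p])
  then have "?b \<in> shadow A" using a shadowI by metis
  moreover have "n = down ?b"
  proof (rule poly_mapping_eqI)
    fix i show "lk n i = lk (down ?b) i"
      using arg_cong[OF a(2), of "\<lambda>q. lk q i"] by (auto simp: lookup_add lookup_minus lk_X)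
  qed
  ultimately show "n \<in> down ` shadow A" by blast
next
  fix n assume "n \<in> down ` shadow A"
  then obtain b k where b: "n = down b" "b + X k \<in> A" by (auto simp: shadow_def)
  then obtain i where i: "k = Suc i" using assms[OF b(2)] by (cases k) (auto simp: lookup_add)
  have "down b + X i = down (b + X k)" unfolding i
    by (rule poly_mapping_eqI) (simp add: lookup_add lk_X)
  then show "n \<in> shadow (down ` A)" using b by (auto simp: shadow_def)
qed

text \<open>
  Substituting \<open>x\<^sub>1\<close> for \<open>x\<^sub>0\<close>. The result is the first monomial of the same degree that is free of \<open>x\<^sub>0\<close> and
  not below the given one (\<open>colex_subst01\<close>, \<open>subst01_le\<close>).\<close>

definition subst01 :: "monom \<Rightarrow> monom" where
  "subst01 y = Poly_Mapping.update 0 0 (Poly_Mapping.update 1 (lk y 0 + lk y 1) y)"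

lemma lk_subst01: "lk (subst01 y) k = (if k = 0 then 0 else if k = 1 then lk y 0 + lk y 1 else lk y k)"
  by (simp add: subst01_def lookup_update)

lemma degree_subst01: "monom_degree (subst01 y) = monom_degree y"
  by (rule line_degree[of _ 1]) (auto simp: line_def lk_subst01)

lemma subst01_X0: "subst01 (y + X 0) = subst01 y + X 1"
  by (rule poly_mapping_eqI) (auto simp: lk_subst01 lookup_add lk_X)

lemma colex_subst01: "y = subst01 y \<or> y \<prec> subst01 y"
proof (cases "lk y 0 = 0")
  case True
  then have "y = subst01 y" by (intro poly_mapping_eqI) (auto simp: lk_subst01)
  then show ?thesis by blast
next
  case False
  then have "lk y 1 < lk (subst01 y) 1 \<and> (\<forall>l>1. lk y l = lk (subst01 y) l)" by (auto simp: lk_subst01)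
  then show ?thesis unfolding colex_def by blast
qed

lemma monom_eq_if_degree_eq:
  assumes "\<And>k. k \<noteq> i \<Longrightarrow> lk m k = lk n k" "monom_degree m = monom_degree n"
  shows "m = n"
proof -
  have le: "m = n" if "lk m i \<le> lk n i" "\<And>k. k \<noteq> i \<Longrightarrow> lk m k = lk n k" "monom_degree m = monom_degree n" for m n
  proof -
    have n: "n = m + Poly_Mapping.single i (lk n i - lk m i)"
      using that by (intro poly_mapping_eqI) (auto simp: lookup_add lookup_single when_def)
    have "monom_degree n = monom_degree m + (lk n i - lk m i)"
      by (subst n) (simp add: monom_degree_add)
    then have "lk m k = lk n k" for k using that by (cases "k = i") auto
    then show ?thesis by (rule poly_mapping_eqI)
  qed
  show ?thesis
  proof (cases "lk m i \<le> lk n i")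
    case True
    then show ?thesis using le[of m n] assms by blast
  next
    case False
    have "n = m" by (rule le) (use False assms in auto)
    then show ?thesis by simp
  qed
qed

lemma subst01_le:
  assumes "y \<prec> w" "lk w 0 = 0" "monom_degree y = monom_degree w"
  shows "subst01 y = w \<or> subst01 y \<prec> w"
proof -
  obtain k where k: "lk y k < lk w k" "\<forall>l>k. lk y l = lk w l" using assms by (auto simp: colex_def)
  then have "k \<noteq> 0" using assms(2) by (metis not_less_zero)
  show ?thesis
  proof (cases "k = 1")
    case True
    have "subst01 y = w"
      by (rule monom_eq_if_degree_eq[of 1]) (use True k assms degree_subst01 in \<open>auto simp: lk_subst01\<close>)
    then show ?thesis by blast
  next
    case False
    then have "lk (subst01 y) k < lk w k \<and> (\<forall>l>k. lk (subst01 y) l = lk w l)"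
      using k \<open>k \<noteq> 0\<close> by (auto simp: lk_subst01)
    then show ?thesis unfolding colex_def by blast
  qed
qed


section \<open>Macaulay's theorem\<close>

text \<open>
  Induction on the degree, and within a degree on the size of \<open>N\<close>, which may be taken stable. For a
  stable set the size of the shadow is the size of the set minus the size of its part free of \<open>x\<^sub>0\<close>.
  If \<open>N\<close> had a smaller shadow than \<open>C\<close>, then its free part would be larger than that of \<open>C\<close>, so at
  least as large as \<open>W\<close>, the free part of \<open>C\<close> together with the next free monomial \<open>w\<close>. By
  the induction on size, the shadow of the free part of \<open>N\<close> is at least as large as that of \<open>W\<close>.
  It lies in the free part of the shadow of \<open>N\<close>, which is bounded through the induction on the degree:
  with \<open>l\<close> the last element of the shadow of \<open>C\<close> and \<open>D\<close> the shadow without \<open>l\<close>, it is at most as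
  large as the free part of \<open>D\<close>. But that free part is a proper subset of the shadow of \<open>W\<close>.\<close>

theorem shadow_initial_minimal:
  assumes "initial d C" "finite N" "N \<subseteq> monoms d" "card C \<le> card N"
  shows "card (shadow C) \<le> card (shadow N)"
  using assms
proof (induction d arbitrary: C N)
  case 0
  then show ?case using shadow_monoms_0[of C] by (simp add: initial_def)
next
  case (Suc d)
  note IHd = Suc.IH
  from Suc.prems show ?case
  proof (induction "card N" arbitrary: C N rule: less_induct)
    case less
    obtain N' where N': "finite N'" "N' \<subseteq> monoms (Suc d)" "card N' = card N"
      "card (shadow N') \<le> card (shadow N)" "x0_stable N'"
      using exists_stable[OF less.prems(2,3)] by blast
    have "card (shadow C) \<le> card (shadow N')"
    proof (rule ccontr)
      assume "\<not> ?thesis"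
      then have neg: "card (shadow N') < card (shadow C)" by simp
      have finC: "finite C" and subC: "C \<subseteq> monoms (Suc d)" using less.prems by (auto simp: initial_def)
      have stC: "x0_stable C" by (rule initial_stable[OF less.prems(1)])
      have eqN: "card (shadow N') + card (zfree N') = card N'" by (rule card_shadow_stable[OF N'(5,1)])
      have eqC: "card (shadow C) + card (zfree C) = card C" by (rule card_shadow_stable[OF stC finC])
      have b: "Suc (card (zfree C)) \<le> card (zfree N')"
        using eqN eqC neg less.prems(4) N'(3) by linarith
      have inS: "initial d (shadow C)" by (rule initial_shadow[OF less.prems(1)])
      have "shadow C \<noteq> {}" using neg by auto
      then obtain l where l: "l \<in> shadow C" "initial d (shadow C - {l})"
        and lmax': "\<forall>m\<in>shadow C. m \<noteq> l \<longrightarrow> m \<prec> l"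
        using initial_remove_max[OF inS] by blast
      let ?D = "shadow C - {l}"
      have lmax: "m \<prec> l" if "m \<in> ?D" for m
        using that lmax' by blast
      have finSC: "finite (shadow C)" by (rule initial_finite[OF inS])
      have "card (shadow N') \<le> card ?D" using neg card_Diff_singleton[OF l(1)] by linarith
      then obtain E where E: "E \<subseteq> ?D" "initial d E" "card E = card (shadow N')"
        using initial_truncate[OF l(2)] by blast
      have finS: "finite (shadow N')" by (rule finite_shadow[OF N'(1)])
      have "card (shadow E) \<le> card (shadow (shadow N'))"
        by (rule IHd[OF E(2) finS shadow_monoms[OF N'(2)]]) (simp add: E(3))
      moreover have "card (shadow E) + card (zfree E) = card E"
        by (rule card_shadow_stable[OF initial_stable[OF E(2)] initial_finite[OF E(2)]])
      moreover have "card (shadow (shadow N')) + card (zfree (shadow N')) = card (shadow N')"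
        by (rule card_shadow_stable[OF stable_shadow[OF N'(5)] finS])
      ultimately have "card (zfree (shadow N')) \<le> card (zfree E)" using E(3) by linarith
      also have "card (zfree E) \<le> card (zfree ?D)"
        by (rule card_mono) (use E(1) finSC in auto)
      finally have le1: "card (zfree (shadow N')) \<le> card (zfree ?D)" .
      \<comment> \<open>\<open>w\<close> is the next monomial free of \<open>x\<^sub>0\<close> after those in \<open>C\<close>.\<close>
      let ?Q = "zfree (monoms (Suc d)) - C"
      obtain k where "k > 0" "Poly_Mapping.single k (Suc d) \<notin> C" using exists_pure_power[OF finC] by blast
      then have "Poly_Mapping.single k (Suc d) \<in> ?Q" by (simp add: monoms_def lookup_single when_def)
      then obtain w where w: "w \<in> ?Q" "\<forall>n\<in>?Q. \<not> n \<prec> w" using colex_least[of ?Q "Suc d"] by blast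
      let ?W = "insert w (zfree C)"
      have Wz: "lk m 0 = 0" if "m \<in> ?W" for m using that w by auto
      have Wdown: "m \<in> ?W" if "n \<in> ?W" "m \<prec> n" "lk m 0 = 0" "monom_degree m = Suc d" for m n
      proof (cases "n = w")
        case True
        then have "m \<notin> ?Q" using w(2) that(2) by blast
        then show ?thesis using that(3,4) by (simp add: monoms_def)
      next
        case False
        then have "n \<in> C" using that(1) by simp
        then have "m \<in> C" using initialD[OF less.prems(1) _ that(2,4)] by blast
        then show ?thesis using that(3) by simp
      qed
      have cW: "card ?W = Suc (card (zfree C))" using w(1) finC by simp
      have inj: "inj_on down A" if "\<And>m. m \<in> A \<Longrightarrow> lk m 0 = 0" for A
        using that by (intro inj_onI) (metis down_inj)
      have iW: "initial (Suc d) (down ` ?W)"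
        unfolding initial_def
      proof (intro conjI ballI impI)
        show "down ` ?W \<subseteq> monoms (Suc d)"
        proof (rule image_subsetI)
          fix m assume m: "m \<in> ?W"
          then have "m \<in> monoms (Suc d)" using w(1) subC by auto
          then show "down m \<in> monoms (Suc d)" using degree_down[OF Wz[OF m]] by (simp add: monoms_def)
        qed
        show "finite (down ` ?W)" using finC by simp
        fix m n assume mn: "m \<in> down ` ?W" "n \<in> monoms (Suc d)" "n \<prec> m"
        then obtain q where q: "q \<in> ?W" "m = down q" by blast
        obtain u where u: "lk u 0 = 0" "down u = n" using down_surj by blast
        have "u \<prec> q" using mn(3) u Wz[OF q(1)] colex_down[of u q] q(2) by simp
        then have "u \<in> ?W" using Wdown[OF q(1)] u mn(2) degree_down[OF u(1)] by (simp add: monoms_def)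
        then show "n \<in> down ` ?W" using u by blast
      qed
      have less_card: "card (zfree N') < card N'"
      proof -
        have "shadow N' \<noteq> {}"
        proof -
          have "N' \<noteq> {}" using b by auto
          then obtain m where m: "m \<in> N'" by blast
          then have "monom_degree m = Suc d" using N'(2) by (auto simp: monoms_def)
          then have "m \<noteq> 0" by (intro notI) simp
          then obtain i where "lk m i > 0" by (metis gr0I lookup_zero poly_mapping_eqI)
          then have "m - X i + X i \<in> N'" using m minus_X_add[of m i] by simp
          then show ?thesis using shadowI by blast
        qed
        then have "card (shadow N') > 0" using finS by (simp add: card_gt_0_iff)
        then show ?thesis using eqN by linarith
      qed
      have zN: "lk m 0 = 0" if "m \<in> zfree N'" for m using that by simp
      have cdN: "card (down ` zfree N') = card (zfree N')" by (rule card_image, rule inj, rule zN)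
      have sdW: "shadow (down ` ?W) = down ` shadow ?W" by (rule shadow_down, rule Wz)
      have sdN: "shadow (down ` zfree N') = down ` shadow (zfree N')" by (rule shadow_down, rule zN)
      have cdW: "card (down ` ?W) = card ?W" by (rule card_image, rule inj, rule Wz)
      have "card (shadow (down ` ?W)) \<le> card (shadow (down ` zfree N'))"
      proof (rule less.hyps[OF _ iW])
        show "card (down ` zfree N') < card N" using cdN less_card N'(3) by simp
        show "finite (down ` zfree N')" using N'(1) by simp
        show "down ` zfree N' \<subseteq> monoms (Suc d)"
        proof (rule image_subsetI)
          fix m assume m: "m \<in> zfree N'"
          then have "m \<in> monoms (Suc d)" using N'(2) by auto
          then show "down m \<in> monoms (Suc d)" using degree_down[OF zN[OF m]] by (simp add: monoms_def)
        qed
        show "card (down ` ?W) \<le> card (down ` zfree N')"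
          unfolding cdN cdW cW by (rule b)
      qed
      moreover have shz: "lk m 0 = 0" if mA: "m \<in> shadow A" and nA: "\<And>n. n \<in> A \<Longrightarrow> lk n 0 = 0" for m A
      proof -
        obtain i where "m + X i \<in> A" using mA by (auto simp: shadow_def)
        then show ?thesis using nA[of "m + X i"] by (simp add: lookup_add)
      qed
      moreover have "card (down ` shadow ?W) = card (shadow ?W)"
        by (rule card_image, rule inj, rule shz, assumption, rule Wz)
      moreover have "card (down ` shadow (zfree N')) = card (shadow (zfree N'))"
        by (rule card_image, rule inj, rule shz, assumption, rule zN)
      ultimately have "card (shadow ?W) \<le> card (shadow (zfree N'))"
        unfolding sdW sdN by linarith
      also have "\<dots> \<le> card (zfree (shadow N'))"
      proof (rule card_mono)
        show "finite (zfree (shadow N'))" using finS by simp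
        show "shadow (zfree N') \<subseteq> zfree (shadow N')"
        proof
          fix m assume m: "m \<in> shadow (zfree N')"
          then have "m \<in> shadow N'" using shadow_mono[of "zfree N'" N'] by blast
          moreover have "lk m 0 = 0" by (rule shz[OF m zN])
          ultimately show "m \<in> zfree (shadow N')" by simp
        qed
      qed
      also note le1
      also have "card (zfree ?D) < card (shadow ?W)"
      proof (rule psubset_card_mono)
        show "finite (shadow ?W)" by (rule finite_shadow) (simp add: finC)
        have lC: "l + X 0 \<in> C" using l(1) stable_shadow_eq[OF stC] by simp
        have wz: "lk w 0 = 0" "monom_degree w = Suc d" "w \<notin> C" using w by (auto simp: monoms_def)
        have degl: "monom_degree (l + X 0) = Suc d" by (rule initial_degree[OF less.prems(1) lC])
        \<comment> \<open>Since \<open>x\<^sub>0 l\<close> lies in \<open>C\<close> and \<open>w\<close> does not, \<open>w\<close> is not below the substituted \<open>x\<^sub>0 l\<close>.\<close>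
        have "l + X 0 \<prec> w"
          using colex_total[of "l + X 0" w] initialD[OF less.prems(1) lC, of w] lC wz(2,3) by blast
        then have sw: "subst01 l + X 1 = w \<or> subst01 l + X 1 \<prec> w"
          using subst01_le[of "l + X 0" w] wz(1,2) degl unfolding subst01_X0 by simp
        have memW: "m \<in> shadow ?W" if "m = subst01 l \<or> m \<prec> subst01 l" "lk m 0 = 0" "monom_degree m = d" for m
        proof -
          have "m + X 1 = w \<or> m + X 1 \<prec> w"
            using that(1) sw colex_add_iff[of m "X 1" "subst01 l"] colex_trans by metis
          then have "m + X 1 \<in> ?W"
            using Wdown[of w "m + X 1"] that by (auto simp: lookup_add lk_X monom_degree_add)
          then show ?thesis by (rule shadowI)
        qed
        \<comment> \<open>This element witnesses that the inclusion is proper.\<close>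
        have sl: "subst01 l \<in> shadow ?W"
          using degl by (intro memW) (auto simp: lk_subst01 degree_subst01 monom_degree_add)
        have "subst01 l \<notin> ?D" using lmax[of "subst01 l"] colex_subst01[of l] colex_asym colex_irrefl by metis
        moreover have "zfree ?D \<subseteq> shadow ?W"
        proof
          fix m assume m: "m \<in> zfree ?D"
          then have "m \<prec> l" using lmax by blast
          then have "m \<prec> subst01 l" using colex_subst01[of l] colex_trans by metis
          then show "m \<in> shadow ?W" using m initial_degree[OF inS, of m] by (intro memW) auto
        qed
        ultimately show "zfree ?D \<subset> shadow ?W" using sl by blast
      qed
      finally show False by simp
    qed
    then show ?case using N'(4) by linarith
  qed
qed

section \<open>Leading monomials and dimensions\<close>

abbreviation cf :: "'k::field_char_0 mpoly \<Rightarrow> monom \<Rightarrow> 'k" where "cf \<equiv> Poly_Mapping.lookup"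
abbreviation supp :: "'k::field_char_0 mpoly \<Rightarrow> monom set" where "supp \<equiv> Poly_Mapping.keys"

lemma cf_Const_mult: "cf (Const c * p) m = c * cf p m"
proof -
  have "Const c * p = Poly_Mapping.map ((*) c) p"
    unfolding Const_def by (rule mult_map_scale_conv_mult[symmetric])
  then show ?thesis by (simp add: map.rep_eq when_def)
qed

lemma cf_monomial_mult: "cf (Poly_Mapping.single m 1 * p) (m + n) = cf p n"
  by (simp add: lookup_mult lookup_single when_mult)

lemma supp_monomial_mult: "supp (Poly_Mapping.single m 1 * p) = (+) m ` supp p"
proof
  show "supp (Poly_Mapping.single m 1 * p) \<subseteq> (+) m ` supp p"
    using keys_mult[of "Poly_Mapping.single m 1" p] by auto
  show "(+) m ` supp p \<subseteq> supp (Poly_Mapping.single m 1 * p)"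
    by (auto simp: in_keys_iff cf_monomial_mult)
qed

text \<open>
  Leading monomials refer to the order \<open><\<close> on monomials, which is compatible with multiplication;
  it is unrelated to the colexicographic order of the previous sections.\<close>

definition lead :: "'k::field_char_0 mpoly \<Rightarrow> monom" where "lead p = Max (supp p)"

definition leads :: "'k::field_char_0 mpoly set \<Rightarrow> monom set" where
  "leads V = lead ` (V - {0})"

lemma lead_in_supp: "p \<noteq> 0 \<Longrightarrow> lead p \<in> supp p"
  unfolding lead_def by (rule Max_in) (auto simp: keys_eq_empty)

lemma lead_monomial_mult:
  assumes "p \<noteq> 0" shows "lead (Poly_Mapping.single m 1 * p) = m + lead p"
  unfolding lead_def supp_monomial_mult
  by (rule hom_Max_commute[symmetric]) (use assms in \<open>auto simp: keys_eq_empty max_def\<close>)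

lemma leads_subset: "(\<And>p. p \<in> V \<Longrightarrow> supp p \<subseteq> A) \<Longrightarrow> leads V \<subseteq> A"
  unfolding leads_def using lead_in_supp by fastforce

lemma leads_mono: "U \<subseteq> V \<Longrightarrow> leads U \<subseteq> leads V"
  by (auto simp: leads_def)

text \<open>
  The step of the inductions over the finite set of monomials that may occur in \<open>V\<close>, which remove
  the largest of them, \<open>b\<close>.\<close>

lemma leads_insert:
  assumes "\<And>p. p \<in> V \<Longrightarrow> supp p \<subseteq> insert b A" "\<And>a. a \<in> A \<Longrightarrow> a < b"
  shows "leads V = leads {p \<in> V. cf p b = 0} \<union> (if \<exists>p\<in>V. cf p b \<noteq> 0 then {b} else {})"
proof -
  have *: "lead p = b" if "p \<in> V" "cf p b \<noteq> 0" for p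
    unfolding lead_def
  proof (rule Max_eqI)
    show "y \<le> b" if "y \<in> supp p" for y
      using assms(1)[OF \<open>p \<in> V\<close>] assms(2) that by (auto simp: less_imp_le)
  qed (use that in \<open>auto simp: in_keys_iff\<close>)
  have "V - {0} = ({p \<in> V. cf p b = 0} - {0}) \<union> {p \<in> V. cf p b \<noteq> 0}" by auto
  then have "leads V = leads {p \<in> V. cf p b = 0} \<union> lead ` {p \<in> V. cf p b \<noteq> 0}"
    unfolding leads_def by (metis image_Un)
  moreover have "lead ` {p \<in> V. cf p b \<noteq> 0} = (if \<exists>p\<in>V. cf p b \<noteq> 0 then {b} else {})"
    using * by auto
  ultimately show ?thesis by simp
qed

definition linear_subspace :: "'k::field_char_0 mpoly set \<Rightarrow> bool" where
  "linear_subspace V \<longleftrightarrow> 0 \<in> V \<and> (\<forall>p\<in>V. \<forall>q\<in>V. p + q \<in> V) \<and> (\<forall>c. \<forall>p\<in>V. Const c * p \<in> V)"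

lemma linear_subspace_reduce:
  assumes "linear_subspace V" "p \<in> V" "q \<in> V" shows "p - Const c * q \<in> V"
proof -
  have eq: "p - Const c * q = p + Const (- c) * q"
    by (rule poly_mapping_eqI) (simp add: lookup_add lookup_minus cf_Const_mult)
  show ?thesis unfolding eq using assms unfolding linear_subspace_def by blast
qed

lemma linear_subspace_cf_zero:
  assumes "linear_subspace V" shows "linear_subspace {p \<in> V. cf p b = 0}"
  using assms by (auto simp: linear_subspace_def lookup_add cf_Const_mult)

text \<open>
  An element of \<open>V\<close> can be reduced to zero by subtracting elements of \<open>U\<close> with the same leading
  monomial.\<close>

lemma subspace_eq_if_leads_eq:
  assumes "finite A" "linear_subspace U" "linear_subspace V" "U \<subseteq> V"
    "\<And>p. p \<in> V \<Longrightarrow> supp p \<subseteq> A" "leads U = leads V"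
  shows "U = V"
  using assms
proof (induction A arbitrary: U V rule: finite_linorder_max_induct)
  case empty
  then show ?case by (auto simp: keys_eq_empty linear_subspace_def)
next
  case (insert b A)
  let ?U = "{p \<in> U. cf p b = 0}" and ?V = "{p \<in> V. cf p b = 0}"
  have lt: "a < b" if "a \<in> A" for a using insert(2) that by blast
  have UV: "p \<in> V" if "p \<in> U" for p using insert.prems(3) that by blast
  have sV: "supp p \<subseteq> A" if "p \<in> ?V" for p using insert.prems(4)[of p] that by (auto simp: in_keys_iff)
  have lU: "leads U = leads ?U \<union> (if \<exists>p\<in>U. cf p b \<noteq> 0 then {b} else {})"
    by (rule leads_insert[OF insert.prems(4)[OF UV] lt])
  have lV: "leads V = leads ?V \<union> (if \<exists>p\<in>V. cf p b \<noteq> 0 then {b} else {})"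
    by (rule leads_insert[OF insert.prems(4) lt])
  have bV: "b \<notin> leads ?V" using leads_subset[of ?V A] sV lt by blast
  have UV': "?U \<subseteq> ?V" using UV by blast
  have bU: "b \<notin> leads ?U" using leads_mono[OF UV'] bV by blast
  have eq: "leads ?U = leads ?V" "(\<exists>p\<in>U. cf p b \<noteq> 0) \<longleftrightarrow> (\<exists>p\<in>V. cf p b \<noteq> 0)"
    using lU lV bU bV insert.prems(5) by (auto split: if_splits)
  have U0: "?U = ?V"
    by (rule insert.IH[OF linear_subspace_cf_zero linear_subspace_cf_zero UV' sV eq(1)])
      (use insert.prems in auto)
  have "p \<in> U" if p: "p \<in> V" for p
  proof (cases "cf p b = 0")
    case True
    then have "p \<in> ?V" using p by simp
    then show ?thesis using U0 by blast
  next
    case False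
    then obtain u where u: "u \<in> U" "cf u b \<noteq> 0" using eq(2) p by blast
    let ?c = "cf p b / cf u b"
    have "p - Const ?c * u \<in> ?V"
      using linear_subspace_reduce[OF insert.prems(2) p UV[OF u(1)], of ?c] u(2)
      by (simp add: lookup_minus cf_Const_mult)
    then have "p - Const ?c * u \<in> U" using U0 by blast
    then have "(p - Const ?c * u) + Const ?c * u \<in> U"
      using u(1) insert.prems(1) unfolding linear_subspace_def by blast
    then show ?thesis by simp
  qed
  then show ?case using UV by blast
qed

locale proper_poly_ideal =
  fixes r :: nat and I :: "'k::field_char_0 mpoly set"
  assumes idl: "ideal I (mpoly_ring r)" and proper: "I \<noteq> carrier (mpoly_ring r)"
begin

abbreviation "Q \<equiv> quot_alg r I"
abbreviation "rs \<equiv> residue r I"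

sublocale P: cring "mpoly_ring r" by (rule cring_mpoly_ring)
sublocale idl: ideal I "mpoly_ring r" by (rule idl)
sublocale Q: cring Q
  unfolding quot_alg_def by (rule idl.quotient_is_cring) (rule cring_mpoly_ring)

lemma I_carrier: "p \<in> I \<Longrightarrow> p \<in> poly_carrier r"
  using idl.a_subset by (auto simp: mpoly_ring_def)

lemma I_zero: "0 \<in> I" using idl.zero_closed by (simp add: mpoly_ring_def)
lemma I_add: "p \<in> I \<Longrightarrow> q \<in> I \<Longrightarrow> p + q \<in> I" using idl.a_closed by (simp add: mpoly_ring_def)
lemma I_mult: "p \<in> I \<Longrightarrow> q \<in> poly_carrier r \<Longrightarrow> q * p \<in> I"
  using idl.I_l_closed by (simp add: mpoly_ring_def)

lemma Const_carrier: "Const c \<in> poly_carrier r"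
  by (auto simp: Const_def poly_carrier_def)

lemma Var_carrier: "j < r \<Longrightarrow> Var j \<in> poly_carrier r"
  by (auto simp: Var_def poly_carrier_def)

lemma subspace_I: "linear_subspace I"
  using I_zero I_add I_mult[OF _ Const_carrier] by (auto simp: linear_subspace_def)

lemma carrier_Q: "carrier Q = rs ` poly_carrier r"
  by (auto simp: quot_alg_def FactRing_def A_RCOSETS_def' residue_def mpoly_ring_def)

lemma rs_hom: "rs \<in> ring_hom (mpoly_ring r) Q"
  unfolding residue_def quot_alg_def by (rule idl.rcos_ring_hom)

lemma rs_closed: "p \<in> poly_carrier r \<Longrightarrow> rs p \<in> carrier Q"
  by (auto simp: carrier_Q)

lemma rs_add: "p \<in> poly_carrier r \<Longrightarrow> q \<in> poly_carrier r \<Longrightarrow> rs (p + q) = rs p \<oplus>\<^bsub>Q\<^esub> rs q"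
  using ring_hom_add[OF rs_hom, of p q] by (simp add: mpoly_ring_def)

lemma rs_mult: "p \<in> poly_carrier r \<Longrightarrow> q \<in> poly_carrier r \<Longrightarrow> rs (p * q) = rs p \<otimes>\<^bsub>Q\<^esub> rs q"
  using ring_hom_mult[OF rs_hom, of p q] by (simp add: mpoly_ring_def)

lemma rs_eq_zero: assumes "p \<in> poly_carrier r" shows "rs p = \<zero>\<^bsub>Q\<^esub> \<longleftrightarrow> p \<in> I"
proof -
  have p: "p \<in> carrier (mpoly_ring r)" using assms by (simp add: mpoly_ring_def)
  have "\<zero>\<^bsub>Q\<^esub> = I" by (simp add: quot_alg_def FactRing_def)
  then show ?thesis using idl.a_rcos_self[OF p] idl.a_rcos_const[of p] by (auto simp: residue_def)
qed

lemma poly_carrier_diff: "p \<in> poly_carrier r \<Longrightarrow> q \<in> poly_carrier r \<Longrightarrow> p - q \<in> poly_carrier r"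
  using poly_carrier_add[of p r "Const (-1) * q"] poly_carrier_mult[OF Const_carrier, of q "-1"]
  by (simp add: Const_def single_uminus)

lemma rs_eq: assumes "p \<in> poly_carrier r" "q \<in> poly_carrier r" shows "rs p = rs q \<longleftrightarrow> p - q \<in> I"
proof -
  have "rs p = rs (p - q) \<oplus>\<^bsub>Q\<^esub> rs q"
    using rs_add[OF poly_carrier_diff[OF assms] assms(2)] by simp
  then have "rs p = rs q \<longleftrightarrow> rs (p - q) = \<zero>\<^bsub>Q\<^esub>"
    using rs_closed assms poly_carrier_diff[OF assms] Q.add.l_cancel_one' Q.l_zero Q.add.r_cancel_one by metis
  then show ?thesis using rs_eq_zero[OF poly_carrier_diff[OF assms]] by simp
qed

text \<open>
  Passing from the subspace of \<open>V\<close> without the largest monomial \<open>b\<close> to \<open>V\<close> itself, the image modulo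
  \<open>I\<close> stays the same if some element of \<open>V \<inter> I\<close> involves \<open>b\<close>, and otherwise grows by one dimension
  as soon as some element of \<open>V\<close> involves \<open>b\<close>. This is exactly how the set of leading monomials
  in the statement changes.\<close>

lemma dimension_residue:
  assumes "finite A" "linear_subspace V" "V \<subseteq> poly_carrier r" "\<And>p. p \<in> V \<Longrightarrow> supp p \<subseteq> A"
  shows "Q.dimension (card (leads V - leads (V \<inter> I))) (scalars r I) (rs ` V)"
  using assms
proof (induction A arbitrary: V rule: finite_linorder_max_induct)
  case empty
  then have "V = {0}" by (auto simp: keys_eq_empty linear_subspace_def)
  moreover have "rs 0 = \<zero>\<^bsub>Q\<^esub>" using rs_eq_zero[of 0] I_zero I_carrier by blast
  ultimately show ?case by (simp add: leads_def)
next
  case (insert b A)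
  let ?V = "{p \<in> V. cf p b = 0}"
  have lt: "a < b" if "a \<in> A" for a using insert(2) that by blast
  have sV: "supp p \<subseteq> A" if "p \<in> ?V" for p using insert.prems(3)[of p] that by (auto simp: in_keys_iff)
  have VI: "{p \<in> V \<inter> I. cf p b = 0} = ?V \<inter> I" by auto
  have lV: "leads V = leads ?V \<union> (if \<exists>p\<in>V. cf p b \<noteq> 0 then {b} else {})"
    by (rule leads_insert[OF insert.prems(3) lt])
  have lI: "leads (V \<inter> I) = leads (?V \<inter> I) \<union> (if \<exists>p\<in>V \<inter> I. cf p b \<noteq> 0 then {b} else {})"
    using leads_insert[of "V \<inter> I", OF insert.prems(3) lt] unfolding VI by blast
  have bV: "b \<notin> leads ?V" using leads_subset[of ?V A] sV lt by blast
  then have bI: "b \<notin> leads (?V \<inter> I)" using leads_mono[of "?V \<inter> I" ?V] by blast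
  have subV: "linear_subspace ?V" by (rule linear_subspace_cf_zero[OF insert.prems(1)])
  have carV: "p \<in> poly_carrier r" if "p \<in> V" for p using insert.prems(2) that by blast
  have IH: "Q.dimension (card (leads ?V - leads (?V \<inter> I))) (scalars r I) (rs ` ?V)"
    by (rule insert.IH[OF subV _ sV]) (use insert.prems(2) in auto)
  have red: "p - Const (cf p b / cf v b) * v \<in> ?V" if "p \<in> V" "v \<in> V" "cf v b \<noteq> 0" for p v
    using linear_subspace_reduce[OF insert.prems(1) that(1,2)] that(3)
    by (simp add: lookup_minus cf_Const_mult)
  show ?case
  proof (cases "\<exists>v\<in>V \<inter> I. cf v b \<noteq> 0")
    case True
    then obtain v where v: "v \<in> V" "v \<in> I" "cf v b \<noteq> 0" by blast
    have "leads V - leads (V \<inter> I) = leads ?V - leads (?V \<inter> I)"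
      using lV lI True v bV by auto
    moreover have "rs ` V = rs ` ?V"
    proof (intro equalityI subsetI)
      fix x assume "x \<in> rs ` V"
      then obtain p where p: "p \<in> V" "x = rs p" by blast
      let ?c = "cf p b / cf v b"
      have q: "p - Const ?c * v \<in> ?V" by (rule red[OF p(1) v(1,3)])
      have "Const ?c * v \<in> I" by (rule I_mult[OF v(2) Const_carrier])
      then have "rs p = rs (p - Const ?c * v)"
        using rs_eq[of p "p - Const ?c * v"] carV p(1) q by simp
      then show "x \<in> rs ` ?V" using q p(2) by blast
    qed auto
    ultimately show ?thesis using IH by simp
  next
    case noI: False
    show ?thesis
    proof (cases "\<exists>v\<in>V. cf v b \<noteq> 0")
      case False
      then have "V = ?V" by auto
      then show ?thesis using IH by simp
    next
      case True
      then obtain v where v: "v \<in> V" "cf v b \<noteq> 0" by blast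
      have "leads V - leads (V \<inter> I) = insert b (leads ?V - leads (?V \<inter> I))"
        using lV lI True noI bI by auto
      moreover have "finite (leads ?V - leads (?V \<inter> I))"
        using leads_subset[of ?V A] sV insert(1) finite_subset by blast
      ultimately have card: "card (leads V - leads (V \<inter> I)) = Suc (card (leads ?V - leads (?V \<inter> I)))"
        using bV by simp
      have "rs v \<notin> rs ` ?V"
      proof
        assume "rs v \<in> rs ` ?V"
        then obtain p where p: "p \<in> ?V" "rs v = rs p" by blast
        then have "v - p \<in> I" using rs_eq[of v p] carV v by blast
        moreover have "v - p \<in> V" using linear_subspace_reduce[OF insert.prems(1) v(1), of p 1] p
          by (simp add: Const_def)
        moreover have "cf (v - p) b \<noteq> 0" using v p by (simp add: lookup_minus)
        ultimately show False using noI by blast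
      qed
      then have "Q.dimension (Suc (card (leads ?V - leads (?V \<inter> I)))) (scalars r I)
          (Q.line_extension (scalars r I) (rs v) (rs ` ?V))"
        using IH rs_closed[OF carV[OF v(1)]] by (intro Q.Suc_dim)
      moreover have "Q.line_extension (scalars r I) (rs v) (rs ` ?V) = rs ` V"
      proof (intro equalityI subsetI)
        fix x assume "x \<in> Q.line_extension (scalars r I) (rs v) (rs ` ?V)"
        then obtain c p where cp: "p \<in> ?V" "x = rs (Const c) \<otimes>\<^bsub>Q\<^esub> rs v \<oplus>\<^bsub>Q\<^esub> rs p"
          unfolding Q.line_extension_mem_iff scalars_def by blast
        have "x = rs (Const c * v + p)"
          using cp carV v(1) by (simp add: rs_add rs_mult poly_carrier_mult Const_carrier)
        moreover have "Const c * v + p \<in> V"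
          using insert.prems(1) cp(1) v(1) by (simp add: linear_subspace_def)
        ultimately show "x \<in> rs ` V" by blast
      next
        fix x assume "x \<in> rs ` V"
        then obtain p where p: "p \<in> V" "x = rs p" by blast
        let ?c = "cf p b / cf v b"
        have q: "p - Const ?c * v \<in> ?V" by (rule red[OF p(1) v])
        have "x = rs (Const ?c * v + (p - Const ?c * v))" using p(2) by simp
        also have "\<dots> = rs (Const ?c) \<otimes>\<^bsub>Q\<^esub> rs v \<oplus>\<^bsub>Q\<^esub> rs (p - Const ?c * v)"
          using carV[OF v(1)] carV[of "p - Const ?c * v"] q
          by (subst rs_add) (auto simp: rs_mult poly_carrier_mult Const_carrier)
        finally show "x \<in> Q.line_extension (scalars r I) (rs v) (rs ` ?V)"
          unfolding Q.line_extension_mem_iff scalars_def using q by blast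
      qed
      ultimately show ?thesis by (simp add: card)
    qed
  qed
qed

lemma alg_dim_residue:
  assumes "finite A" "linear_subspace V" "V \<subseteq> poly_carrier r" "\<And>p. p \<in> V \<Longrightarrow> supp p \<subseteq> A"
  shows "alg_dim r I (rs ` V) = card (leads V - leads (V \<inter> I))"
  using Q.dimI[OF subfield_scalars[OF idl proper] dimension_residue[OF assms]]
  by (simp add: alg_dim_def over_def)

end

section \<open>Standard monomials and the socle\<close>

definition monoms_in :: "nat \<Rightarrow> nat \<Rightarrow> monom set" where
  "monoms_in r d = {m. Poly_Mapping.keys m \<subseteq> {..<r} \<and> monom_degree m = d}"

lemma finite_monoms_in: "finite (monoms_in r d)"
  unfolding monoms_in_def by (rule finite_bounded_monoms)

lemma monoms_in_monoms: "monoms_in r d \<subseteq> monoms d"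
  by (auto simp: monoms_in_def monoms_def)

lemma forms_iff: "p \<in> forms r d \<longleftrightarrow> supp p \<subseteq> monoms_in r d"
  by (auto simp: forms_def poly_carrier_def monoms_in_def)

lemma forms_carrier: "p \<in> forms r d \<Longrightarrow> p \<in> poly_carrier r"
  by (simp add: forms_def)

lemma linear_subspace_supp: "linear_subspace {p. supp p \<subseteq> A}"
  by (auto simp: linear_subspace_def in_keys_iff subset_iff lookup_add cf_Const_mult)
    (metis add_0)

lemma forms_eq: "forms r d = {p. supp p \<subseteq> monoms_in r d}"
  using forms_iff by blast

lemma linear_subspace_forms: "linear_subspace (forms r d)"
  unfolding forms_eq by (rule linear_subspace_supp)

lemma single_one_nonzero: "Poly_Mapping.single m (1::'k::field_char_0) \<noteq> 0"
  by (metis lookup_single_eq lookup_zero one_neq_zero)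

lemma leads_supp: "leads {p :: 'k::field_char_0 mpoly. supp p \<subseteq> A} = A"
proof
  show "leads {p :: 'k mpoly. supp p \<subseteq> A} \<subseteq> A" by (rule leads_subset) auto
  show "A \<subseteq> leads {p :: 'k mpoly. supp p \<subseteq> A}"
  proof
    fix m assume "m \<in> A"
    then have "Poly_Mapping.single m (1::'k) \<in> {p. supp p \<subseteq> A} - {0}"
      using single_one_nonzero[of m] by simp
    moreover have "lead (Poly_Mapping.single m (1::'k)) = m" by (simp add: lead_def)
    ultimately show "m \<in> leads {p :: 'k mpoly. supp p \<subseteq> A}" unfolding leads_def by (metis imageI)
  qed
qed


lemma Var_mult_forms:
  assumes "j < r" "p \<in> forms r d" shows "Var j * p \<in> forms r (Suc d)"
  using assms unfolding forms_iff Var_def supp_monomial_mult monoms_in_def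
  by (auto simp: monom_degree_add dest!: subsetD[OF Poly_Mapping.keys_add])

definition std_monoms :: "nat \<Rightarrow> 'k::field_char_0 mpoly set \<Rightarrow> nat \<Rightarrow> monom set" where
  "std_monoms r I d = monoms_in r d - leads (forms r d \<inter> I)"

text \<open>The forms of degree \<open>d\<close> whose residue classes lie in the socle.\<close>

definition socle_forms :: "nat \<Rightarrow> 'k::field_char_0 mpoly set \<Rightarrow> nat \<Rightarrow> 'k mpoly set" where
  "socle_forms r I d = {p \<in> forms r d. \<forall>j<r. Var j * p \<in> I}"

lemma finite_std_monoms: "finite (std_monoms r I d)"
  unfolding std_monoms_def using finite_monoms_in by blast

lemma std_monoms_monoms: "std_monoms r I d \<subseteq> monoms d"
  unfolding std_monoms_def using monoms_in_monoms by blast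

lemma ideal_mpoly_ringI:
  fixes P :: "'k::field_char_0 mpoly set"
  assumes "0 \<in> P" "P \<subseteq> poly_carrier r" "\<And>p q. p \<in> P \<Longrightarrow> q \<in> P \<Longrightarrow> p + q \<in> P"
    "\<And>p q. p \<in> P \<Longrightarrow> q \<in> poly_carrier r \<Longrightarrow> q * p \<in> P"
  shows "ideal P (mpoly_ring r)"
proof -
  interpret P: cring "mpoly_ring r :: 'k mpoly ring" by (rule cring_mpoly_ring)
  show ?thesis
  proof (rule idealI)
    show "ring (mpoly_ring r :: 'k mpoly ring)" by (rule P.ring_axioms)
    show "subgroup P (add_monoid (mpoly_ring r))"
    proof (rule P.add.subgroupI)
      fix p assume p: "p \<in> P"
      have "Const (- 1) \<in> poly_carrier r" by (auto simp: Const_def poly_carrier_def)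
      then have m: "- p \<in> P" using assms(4)[OF p, of "Const (- 1)"] by (simp add: Const_def single_uminus)
      have "\<ominus>\<^bsub>mpoly_ring r\<^esub> p = - p"
        by (rule P.minus_equality) (use m p assms(2) in \<open>auto simp: mpoly_ring_def\<close>)
      then show "\<ominus>\<^bsub>mpoly_ring r\<^esub> p \<in> P" using m by simp
    qed (use assms(1-3) in \<open>auto simp: mpoly_ring_def\<close>)
  next
    fix p q :: "'k mpoly" assume pq: "p \<in> P" "q \<in> carrier (mpoly_ring r)"
    then have "q * p \<in> P" using assms(4)[OF pq(1), of q] by (simp add: mpoly_ring_def)
    then show "q \<otimes>\<^bsub>mpoly_ring r\<^esub> p \<in> P" "p \<otimes>\<^bsub>mpoly_ring r\<^esub> q \<in> P"
      by (simp_all add: mpoly_ring_def mult.commute)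
  qed
qed

context proper_poly_ideal
begin

lemma alg_dim_graded_piece: "alg_dim r I (graded_piece r I d) = card (std_monoms r I d)"
proof -
  have "alg_dim r I (rs ` forms r d) = card (leads (forms r d :: 'k mpoly set) - leads (forms r d \<inter> I))"
    by (rule alg_dim_residue[OF finite_monoms_in linear_subspace_forms])
      (auto simp: forms_iff dest: forms_carrier)
  then show ?thesis by (simp add: graded_piece_def std_monoms_def forms_eq leads_supp)
qed

lemma forms_subset_iff_std: "forms r d \<subseteq> I \<longleftrightarrow> std_monoms r I d = {}"
proof
  assume "forms r d \<subseteq> I"
  then have "forms r d \<inter> I = (forms r d :: 'k mpoly set)" by blast
  then show "std_monoms r I d = {}" by (simp add: std_monoms_def forms_eq leads_supp)
next
  assume s: "std_monoms r I d = {}"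
  have sub: "linear_subspace (forms r d \<inter> I)"
    using linear_subspace_forms subspace_I unfolding linear_subspace_def by blast
  have "leads (forms r d :: 'k mpoly set) = monoms_in r d" unfolding forms_eq by (rule leads_supp)
  then have "leads (forms r d \<inter> I) = leads (forms r d :: 'k mpoly set)"
    using s leads_mono[of "forms r d \<inter> I" "forms r d"] by (auto simp: std_monoms_def)
  then have "forms r d \<inter> I = forms r d"
    by (intro subspace_eq_if_leads_eq[OF finite_monoms_in sub linear_subspace_forms, of r d])
      (auto simp: forms_iff)
  then show "forms r d \<subseteq> I" by blast
qed

text \<open>
  The annihilator of a residue class is an ideal, so it contains the ideal generated by the variables
  as soon as it contains the variables.\<close>

lemma residue_in_socle:
  assumes p: "p \<in> poly_carrier r"
  shows "rs p \<in> socle r I \<longleftrightarrow> (\<forall>j<r. Var j * p \<in> I)"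
proof -
  have gens: "(\<lambda>j. rs (Var j)) ` {..<r} \<subseteq> carrier Q" using rs_closed Var_carrier by auto
  have prod: "rs p \<otimes>\<^bsub>Q\<^esub> rs (Var j) = \<zero>\<^bsub>Q\<^esub> \<longleftrightarrow> Var j * p \<in> I" if "j < r" for j
    using rs_mult[OF p Var_carrier[OF that]] rs_eq_zero[OF poly_carrier_mult[OF p Var_carrier[OF that]]]
    by (simp add: mult.commute)
  show ?thesis
  proof
    assume "rs p \<in> socle r I"
    then show "\<forall>j<r. Var j * p \<in> I"
      using Q.genideal_self[OF gens] prod unfolding socle_def max_ideal_def by blast
  next
    assume a: "\<forall>j<r. Var j * p \<in> I"
    let ?J = "{b \<in> carrier Q. rs p \<otimes>\<^bsub>Q\<^esub> b = \<zero>\<^bsub>Q\<^esub>}"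
    have pc: "rs p \<in> carrier Q" by (rule rs_closed[OF p])
    have "ideal ?J Q"
    proof (rule idealI)
      show "ring Q" by (rule Q.ring_axioms)
      show "subgroup ?J (add_monoid Q)"
        by (rule Q.add.subgroupI) (use pc in \<open>auto simp: Q.r_distr Q.r_minus a_inv_def[symmetric]\<close>)
      show "x \<otimes>\<^bsub>Q\<^esub> b \<in> ?J" if "b \<in> ?J" "x \<in> carrier Q" for b x
        using that pc by (auto simp: Q.m_lcomm)
      show "b \<otimes>\<^bsub>Q\<^esub> x \<in> ?J" if "b \<in> ?J" "x \<in> carrier Q" for b x
        using that pc by (auto simp flip: Q.m_assoc)
    qed
    moreover have "(\<lambda>j. rs (Var j)) ` {..<r} \<subseteq> ?J" using a prod gens by auto
    ultimately have "max_ideal r I \<subseteq> ?J" unfolding max_ideal_def by (rule Q.genideal_minimal)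
    then show "rs p \<in> socle r I" using pc unfolding socle_def by blast
  qed
qed

lemma socle_graded_piece: "socle r I \<inter> graded_piece r I d = rs ` socle_forms r I d"
proof -
  have "socle r I \<inter> graded_piece r I d = rs ` {p \<in> forms r d. rs p \<in> socle r I}"
    unfolding graded_piece_def by blast
  also have "{p \<in> forms r d. rs p \<in> socle r I} = socle_forms r I d"
    unfolding socle_forms_def using residue_in_socle[OF forms_carrier] by blast
  finally show ?thesis .
qed

lemma alg_dim_socle:
  "alg_dim r I (socle r I \<inter> graded_piece r I d)
    = card (leads (socle_forms r I d) - leads (forms r d \<inter> I))"
proof -
  have sub: "linear_subspace (socle_forms r I d)"
    using linear_subspace_forms[of r d] I_zero I_add I_mult[OF _ Const_carrier]
    by (auto simp: linear_subspace_def socle_forms_def distrib_left mult.left_commute)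
  have int: "socle_forms r I d \<inter> I = forms r d \<inter> I"
    using I_mult Var_carrier by (auto simp: socle_forms_def)
  have sf: "p \<in> forms r d" if "p \<in> socle_forms r I d" for p
    using that by (simp add: socle_forms_def)
  have "alg_dim r I (rs ` socle_forms r I d)
      = card (leads (socle_forms r I d) - leads (socle_forms r I d \<inter> I))"
  proof (rule alg_dim_residue[OF finite_monoms_in sub])
    show "socle_forms r I d \<subseteq> poly_carrier r" using sf forms_carrier by blast
    show "supp p \<subseteq> monoms_in r d" if "p \<in> socle_forms r I d" for p
      using sf[OF that] by (simp add: forms_iff)
  qed
  then show ?thesis unfolding socle_graded_piece int .
qed

text \<open>
  If \<open>m\<close> were the leading monomial of a form \<open>p\<close> in the socle, then \<open>x\<^sub>j p \<in> I\<close> would have the leading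
  monomial \<open>x\<^sub>j m\<close>, which could then not be standard.\<close>

lemma shadow_std_monoms:
  "shadow (std_monoms r I (Suc d)) \<subseteq> monoms_in r d - leads (socle_forms r I d)"
proof
  fix m assume "m \<in> shadow (std_monoms r I (Suc d))"
  then obtain j where j: "m + X j \<in> std_monoms r I (Suc d)" by (auto simp: shadow_def)
  then have b: "Poly_Mapping.keys (m + X j) \<subseteq> {..<r}" "monom_degree m = d"
    by (auto simp: std_monoms_def monoms_in_def monom_degree_add)
  have "k \<in> Poly_Mapping.keys (m + X j)" if "k \<in> Poly_Mapping.keys m" for k
    using that by (simp add: in_keys_iff lookup_add)
  moreover have "j \<in> Poly_Mapping.keys (m + X j)" by (simp add: in_keys_iff lookup_add)
  ultimately have m: "m \<in> monoms_in r d" and jr: "j < r" using b by (auto simp: monoms_in_def)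
  have "m \<notin> leads (socle_forms r I d)"
  proof
    assume "m \<in> leads (socle_forms r I d)"
    then obtain p where p: "p \<in> forms r d" "Var j * p \<in> I" "p \<noteq> 0" "m = lead p"
      using jr by (auto simp: leads_def socle_forms_def)
    have l: "lead (Var j * p) = m + X j"
      using lead_monomial_mult[OF p(3), of "X j"] p(4) by (simp add: Var_def add.commute)
    have "Var j * p \<noteq> 0"
      using supp_monomial_mult[of "X j" p] p(3) by (auto simp: Var_def keys_eq_empty)
    then have "m + X j \<in> leads (forms r (Suc d) \<inter> I)"
      using p(2) Var_mult_forms[OF jr p(1)] l unfolding leads_def by (metis DiffI IntI imageI singletonD)
    then show False using j by (simp add: std_monoms_def)
  qed
  then show "m \<in> monoms_in r d - leads (socle_forms r I d)" using m by blast
qed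

text \<open>
  The difference of the two dimensions is the number of monomials that are not leading monomials of
  socle forms, and the shadow of the standard monomials consists of such monomials.\<close>

theorem socle_plus_shadow_le:
  "alg_dim r I (socle r I \<inter> graded_piece r I d) + card (shadow (std_monoms r I (Suc d)))
    \<le> alg_dim r I (graded_piece r I d)"
proof -
  let ?M = "monoms_in r d" and ?S = "leads (socle_forms r I d)" and ?L = "leads (forms r d \<inter> I)"
  have S: "?S \<subseteq> ?M" by (rule leads_subset) (auto simp: socle_forms_def forms_iff)
  have L: "?L \<subseteq> ?S"
  proof (rule leads_mono)
    show "forms r d \<inter> I \<subseteq> socle_forms r I d"
      unfolding socle_forms_def using I_mult[OF _ Var_carrier] by blast
  qed
  have "card (?S - ?L) + card (shadow (std_monoms r I (Suc d))) \<le> card (?S - ?L) + card (?M - ?S)"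
    using card_mono[OF _ shadow_std_monoms[of d]] finite_monoms_in by simp
  also have "\<dots> = card ((?S - ?L) \<union> (?M - ?S))"
    by (rule card_Un_disjoint[symmetric]) (use finite_monoms_in finite_subset[OF S] in auto)
  also have "(?S - ?L) \<union> (?M - ?S) = ?M - ?L" using S L by blast
  finally show ?thesis by (simp add: alg_dim_socle alg_dim_graded_piece std_monoms_def)
qed

lemma socle_eq_graded_piece:
  assumes "forms r (Suc d) \<subseteq> I"
  shows "socle r I \<inter> graded_piece r I d = graded_piece r I d"
proof -
  have "socle_forms r I d = (forms r d :: 'k mpoly set)"
    using assms Var_mult_forms unfolding socle_forms_def by blast
  then show ?thesis unfolding socle_graded_piece by (simp add: graded_piece_def)
qed

lemma forms_0_not_subset: "\<not> forms r 0 \<subseteq> I"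
proof
  assume "forms r 0 \<subseteq> I"
  moreover have "1 \<in> forms r 0" by (auto simp: forms_def poly_carrier_def)
  ultimately have "\<one>\<^bsub>mpoly_ring r\<^esub> \<in> I" by (auto simp: mpoly_ring_def)
  then show False using idl.one_imp_carrier proper by blast
qed

lemma std_monoms_0: "std_monoms r I 0 = {0}"
proof -
  have "monoms_in r 0 = {0}" by (auto simp: monoms_in_def monom_degree_eq_0_iff)
  then have "std_monoms r I 0 \<subseteq> {0}" by (auto simp: std_monoms_def)
  then show ?thesis using forms_0_not_subset forms_subset_iff_std by blast
qed

lemma graded_piece_zero_iff: "graded_piece r I d = {\<zero>\<^bsub>Q\<^esub>} \<longleftrightarrow> forms r d \<subseteq> I"
proof -
  have "0 \<in> forms r d" by (simp add: forms_def poly_carrier_def)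
  then have "rs ` forms r d = {\<zero>\<^bsub>Q\<^esub>} \<longleftrightarrow> (\<forall>p\<in>forms r d. rs p = \<zero>\<^bsub>Q\<^esub>)" by blast
  also have "\<dots> \<longleftrightarrow> (\<forall>p\<in>forms r d. p \<in> I)" using rs_eq_zero[OF forms_carrier] by blast
  finally show ?thesis unfolding graded_piece_def by blast
qed

lemma top_degreeI:
  assumes "\<not> forms r e \<subseteq> I" "\<And>d. d > e \<Longrightarrow> forms r d \<subseteq> I"
  shows "top_degree r I = e"
  unfolding top_degree_def graded_piece_zero_iff
  by (rule Greatest_equality) (use assms not_le_imp_less in blast)+

lemma top_degree_props:
  assumes "\<And>d. d \<ge> N \<Longrightarrow> forms r d \<subseteq> I"
  shows "\<not> forms r (top_degree r I) \<subseteq> I" "d > top_degree r I \<Longrightarrow> forms r d \<subseteq> I"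
proof -
  have b: "d \<le> N" if "\<not> forms r d \<subseteq> I" for d using assms[of d] that by linarith
  show "\<not> forms r (top_degree r I) \<subseteq> I"
    unfolding top_degree_def graded_piece_zero_iff
    by (rule GreatestI_nat[where P = "\<lambda>d. \<not> forms r d \<subseteq> I", OF forms_0_not_subset]) (use b in blast)
  show "forms r d \<subseteq> I" if "d > top_degree r I"
  proof (rule ccontr)
    assume "\<not> forms r d \<subseteq> I"
    then have "d \<le> top_degree r I"
      unfolding top_degree_def graded_piece_zero_iff
      by (rule Greatest_le_nat[where P = "\<lambda>d. \<not> forms r d \<subseteq> I"]) (use b in blast)
    then show False using that by simp
  qed
qed

lemma ideal_residue_image:
  assumes "0 \<in> P" "P \<subseteq> poly_carrier r" "\<And>p q. p \<in> P \<Longrightarrow> q \<in> P \<Longrightarrow> p + q \<in> P"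
    "\<And>p q. p \<in> P \<Longrightarrow> q \<in> poly_carrier r \<Longrightarrow> q * p \<in> P"
  shows "ideal (rs ` P) Q"
  using P.ring_ideal_imp_quot_ideal[OF idl ideal_mpoly_ringI[OF assms]]
  unfolding residue_def quot_alg_def .

end

lemma cf_hom_component: "cf (hom_component d p) m = (if monom_degree m = d then cf p m else 0)"
proof -
  have "cf (hom_component d p) m
    = (\<Sum>n\<in>{n \<in> supp p. monom_degree n = d}. if n = m then cf p n else 0)"
    unfolding hom_component_def lookup_sum by (rule sum.cong) (auto simp: lookup_single when_def)
  also have "\<dots> = (if monom_degree m = d then cf p m else 0)"
    by (simp add: sum.delta in_keys_iff)
  finally show ?thesis .
qed

lemma standard_proper: "standard_graded_artinian r I \<Longrightarrow> proper_poly_ideal r I"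
  by (rule proper_poly_ideal.intro) (auto simp: standard_graded_artinian_def homogeneous_ideal_def)

text \<open>
  The images of the ideals of polynomials without terms of degree below \<open>n\<close> form a descending
  chain. Where it is stationary, a form of degree \<open>d\<close> is congruent modulo \<open>I\<close> to a polynomial of higher
  order; taking the component of degree \<open>d\<close> shows that the form lies in \<open>I\<close>.\<close>

lemma eventually_forms_subset:
  fixes I :: "'k::field_char_0 mpoly set"
  assumes "standard_graded_artinian r I"
  shows "\<exists>N. \<forall>d\<ge>N. forms r d \<subseteq> I"
proof -
  have hi: "homogeneous_ideal r I" and art: "artinian_ring (quot_alg r I)"
    using assms by (auto simp: standard_graded_artinian_def)
  interpret proper_poly_ideal r I by (rule standard_proper[OF assms])
  define P :: "nat \<Rightarrow> 'k mpoly set" where "P n = {p \<in> poly_carrier r. \<forall>m\<in>supp p. n \<le> monom_degree m}" for n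
  have "ideal (rs ` P n) Q \<and> rs ` P (Suc n) \<subseteq> rs ` P n" for n
  proof
    show "ideal (rs ` P n) Q"
    proof (rule ideal_residue_image)
      show "0 \<in> P n" by (simp add: P_def poly_carrier_def)
      show "P n \<subseteq> poly_carrier r" by (auto simp: P_def)
      show "p + q \<in> P n" if "p \<in> P n" "q \<in> P n" for p q
        using that Poly_Mapping.keys_add[of p q] poly_carrier_add[of p r q] by (auto simp: P_def)
      show "q * p \<in> P n" if "p \<in> P n" "q \<in> poly_carrier r" for p q
      proof -
        have "n \<le> monom_degree m" if m: "m \<in> supp (q * p)" for m
        proof -
          obtain a b where "b \<in> supp p" "m = a + b" using keys_mult[of q p] m by blast
          then show ?thesis using \<open>p \<in> P n\<close> by (auto simp: P_def monom_degree_add intro: trans_le_add2)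
        qed
        then show ?thesis using that poly_carrier_mult[of q r p] by (auto simp: P_def)
      qed
    qed
    show "rs ` P (Suc n) \<subseteq> rs ` P n" by (rule image_mono) (auto simp: P_def)
  qed
  then obtain N where N: "\<forall>n\<ge>N. rs ` P n = rs ` P N"
    using art unfolding artinian_ring_def by (elim conjE allE[of _ "\<lambda>n. rs ` P n"]) blast
  have "forms r d \<subseteq> I" if d: "d \<ge> N" for d
  proof
    fix p :: "'k mpoly" assume p: "p \<in> forms r d"
    then have "p \<in> P d" by (simp add: P_def forms_def)
    moreover have "rs ` P d = rs ` P (Suc d)"
      by (rule trans[OF N[rule_format, OF d] N[rule_format, OF le_SucI[OF d], symmetric]])
    ultimately obtain q where q: "q \<in> P (Suc d)" "rs p = rs q" by blast
    have "p - q \<in> I" using rs_eq[of p q] q forms_carrier[OF p] by (simp add: P_def)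
    then have "hom_component d (p - q) \<in> I" using hi by (simp add: homogeneous_ideal_def)
    moreover have "hom_component d (p - q) = p"
    proof (rule poly_mapping_eqI)
      fix m
      have "cf q m = 0" if "monom_degree m = d"
      proof (rule ccontr)
        assume "cf q m \<noteq> 0"
        then have "m \<in> supp q" by (simp add: in_keys_iff)
        then show False using q(1) that by (force simp: P_def)
      qed
      moreover have "cf p m = 0" if "monom_degree m \<noteq> d"
        using p that by (auto simp: forms_def in_keys_iff)
      ultimately show "cf (hom_component d (p - q)) m = cf p m"
        by (simp add: cf_hom_component lookup_minus)
    qed
    ultimately show "p \<in> I" by simp
  qed
  then show ?thesis by blast
qed

section \<open>The algebra of an order ideal of monomials\<close>

definition monomial_ideal :: "nat \<Rightarrow> monom set \<Rightarrow> 'k::field_char_0 mpoly set" where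
  "monomial_ideal r N = {p \<in> poly_carrier r. supp p \<inter> N = {}}"

lemma monoms_1: "monoms 1 = range X"
proof (intro equalityI subsetI)
  fix m assume m: "m \<in> monoms 1"
  then have "m \<noteq> 0" by (auto simp: monoms_def)
  then obtain m' i where i: "m = m' + X i" using monom_split by blast
  then have "m' = 0" using m by (simp add: monoms_def monom_degree_add monom_degree_eq_0_iff)
  then show "m \<in> range X" using i by simp
qed (auto simp: monoms_def)

locale order_ideal =
  fixes r :: nat and N :: "monom set"
  assumes fin: "finite N" and zero: "0 \<in> N"
    and closed: "\<And>m j. m + X j \<in> N \<Longrightarrow> m \<in> N"
    and variables: "\<And>j. X j \<in> N \<longleftrightarrow> j < r"
begin

lemma factor: "a + b \<in> N \<Longrightarrow> b \<in> N"
proof (induction "monom_degree a" arbitrary: a)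
  case 0
  then show ?case using monom_degree_eq_0_iff[of a] by simp
next
  case (Suc d)
  then have "a \<noteq> 0" by (intro notI) simp
  then obtain a' i where a: "a = a' + X i" using monom_split by blast
  have "(a' + b) + X i \<in> N" using Suc.prems a by (simp add: ac_simps)
  then show ?case using closed Suc.hyps(1)[of a'] Suc.hyps(2) a by (simp add: monom_degree_add)
qed

lemma keys_bounded: assumes "m \<in> N" shows "Poly_Mapping.keys m \<subseteq> {..<r}"
proof
  fix k assume "k \<in> Poly_Mapping.keys m"
  then have "lk m k > 0" by (simp add: in_keys_iff)
  then have "m - X k + X k \<in> N" using assms minus_X_add[of m k] by simp
  then show "k \<in> {..<r}" using factor variables by blast
qed

lemma monoms_in_inter: "monoms_in r d \<inter> N = N \<inter> monoms d"
  using keys_bounded by (auto simp: monoms_in_def monoms_def)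

lemma ideal_monomial_ideal: "ideal (monomial_ideal r N) (mpoly_ring r)"
proof (rule ideal_mpoly_ringI)
  show "0 \<in> monomial_ideal r N" by (simp add: monomial_ideal_def poly_carrier_def)
  show "p + q \<in> monomial_ideal r N" if "p \<in> monomial_ideal r N" "q \<in> monomial_ideal r N" for p q
    using that Poly_Mapping.keys_add[of p q] poly_carrier_add[of p r q]
    unfolding monomial_ideal_def by blast
  show "q * p \<in> monomial_ideal r N" if p: "p \<in> monomial_ideal r N" and q: "q \<in> poly_carrier r" for p q
  proof -
    have "m \<notin> N" if m: "m \<in> supp (q * p)" for m
    proof -
      obtain a b where "b \<in> supp p" "m = a + b" using keys_mult[of q p] m by blast
      then show ?thesis using factor p unfolding monomial_ideal_def by blast
    qed
    then show ?thesis using p q poly_carrier_mult[of q r p] unfolding monomial_ideal_def by blast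
  qed
qed (auto simp: monomial_ideal_def)

lemma proper_monomial_ideal: "proper_poly_ideal r (monomial_ideal r N :: 'k::field_char_0 mpoly set)"
proof (rule proper_poly_ideal.intro[OF ideal_monomial_ideal])
  have "1 \<in> carrier (mpoly_ring r :: 'k mpoly ring)" by (simp add: mpoly_ring_def poly_carrier_def)
  moreover have "1 \<notin> (monomial_ideal r N :: 'k mpoly set)" using zero by (simp add: monomial_ideal_def)
  ultimately show "(monomial_ideal r N :: 'k mpoly set) \<noteq> carrier (mpoly_ring r)" by blast
qed

lemma forms_inter_monomial_ideal:
  "forms r d \<inter> monomial_ideal r N = {p. supp p \<subseteq> monoms_in r d - N}"
  using forms_carrier by (auto simp: monomial_ideal_def forms_iff)

lemma std_monoms_monomial_ideal: "std_monoms r (monomial_ideal r N) d = N \<inter> monoms d"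
  unfolding std_monoms_def forms_inter_monomial_ideal leads_supp using monoms_in_inter[of d] by blast

lemma alg_dim_socle_monomial_ideal:
  fixes I :: "'k::field_char_0 mpoly set"
  defines "I \<equiv> monomial_ideal r N"
  shows "alg_dim r I (socle r I \<inter> graded_piece r I d) = card (N \<inter> monoms d - shadow N)"
proof -
  interpret proper_poly_ideal r I unfolding I_def by (rule proper_monomial_ideal)
  let ?K = "{m \<in> monoms_in r d. \<forall>j<r. m + X j \<notin> N}"
  have sV: "supp (Var j * p) = (\<lambda>m. m + X j) ` supp p" for j and p :: "'k mpoly"
    unfolding Var_def supp_monomial_mult by (rule image_cong) (simp_all add: add.commute)
  have Vm: "Var j * p \<in> I \<longleftrightarrow> (\<forall>m\<in>supp p. m + X j \<notin> N)" if "j < r" "p \<in> poly_carrier r" for j p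
    using poly_carrier_mult[OF Var_carrier[OF that(1)] that(2)]
    unfolding I_def monomial_ideal_def by (auto simp only: sV mem_Collect_eq)
  have "socle_forms r I d = {p. supp p \<subseteq> ?K}"
  proof (rule Set.set_eqI)
    fix p :: "'k mpoly"
    have "p \<in> socle_forms r I d \<longleftrightarrow> p \<in> forms r d \<and> (\<forall>j<r. \<forall>m\<in>supp p. m + X j \<notin> N)"
      using Vm forms_carrier unfolding socle_forms_def by blast
    also have "\<dots> \<longleftrightarrow> supp p \<subseteq> ?K" unfolding forms_iff by blast
    finally show "p \<in> socle_forms r I d \<longleftrightarrow> p \<in> {p. supp p \<subseteq> ?K}" by simp
  qed
  then have "leads (socle_forms r I d) = ?K" by (simp only: leads_supp)
  moreover have "leads (forms r d \<inter> I) = monoms_in r d - N"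
    unfolding I_def forms_inter_monomial_ideal leads_supp ..
  moreover have "?K - (monoms_in r d - N) = N \<inter> monoms d - shadow N"
  proof -
    have "j < r" if "m + X j \<in> N" for m j using factor[OF that] variables by blast
    then have "(\<forall>j<r. m + X j \<notin> N) \<longleftrightarrow> m \<notin> shadow N" for m by (auto simp: shadow_def)
    then show ?thesis using monoms_in_inter[of d] by blast
  qed
  ultimately show ?thesis by (simp only: alg_dim_socle)
qed

text \<open>
  An ideal of the quotient is determined by its representatives supported on the finite set \<open>N\<close>; along
  a descending chain the finite sets of leading monomials of these representatives become stationary,
  and then so do the spaces of representatives.\<close>

lemma artinian_monomial_ideal: "artinian_ring (quot_alg r (monomial_ideal r N :: 'k::field_char_0 mpoly set))"
proof -
  define I where "I = (monomial_ideal r N :: 'k mpoly set)"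
  interpret proper_poly_ideal r I unfolding I_def by (rule proper_monomial_ideal)
  have "\<exists>n0. \<forall>n\<ge>n0. J n = J n0" if J: "\<And>n. ideal (J n) Q \<and> J (Suc n) \<subseteq> J n" for J
  proof -
    define U where "U n = {p. supp p \<subseteq> N \<and> rs p \<in> J n}" for n
    have sN: "p \<in> poly_carrier r" if "supp p \<subseteq> N" for p :: "'k mpoly"
      using that keys_bounded by (auto simp: poly_carrier_def)
    have JU: "J n = rs ` U n" for n
    proof (intro equalityI subsetI)
      interpret Jn: ideal "J n" Q using J by blast
      fix x assume x: "x \<in> J n"
      then obtain p where p: "p \<in> poly_carrier r" "x = rs p" using Jn.a_subset carrier_Q by blast
      \<comment> \<open>Dropping the terms outside \<open>N\<close> does not change the residue class.\<close>
      define q where "q = (\<Sum>m\<in>supp p \<inter> N. Poly_Mapping.single m (cf p m))"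
      have cq: "cf q m = (if m \<in> N then cf p m else 0)" for m
      proof -
        have "cf q m = (\<Sum>n\<in>supp p \<inter> N. if n = m then cf p n else 0)"
          unfolding q_def lookup_sum by (rule sum.cong) (auto simp: lookup_single when_def)
        also have "\<dots> = (if m \<in> N then cf p m else 0)" by (simp add: sum.delta in_keys_iff)
        finally show ?thesis .
      qed
      have sq: "supp q \<subseteq> N" by (auto simp: in_keys_iff cq split: if_splits)
      have "supp (p - q) \<inter> N = {}" by (auto simp: in_keys_iff lookup_minus cq)
      then have "p - q \<in> I"
        using poly_carrier_diff[OF p(1) sN[OF sq]] unfolding I_def monomial_ideal_def by blast
      then have "x = rs q" using rs_eq[OF p(1) sN[OF sq]] p(2) by blast
      then show "x \<in> rs ` U n" using sq x unfolding U_def by blast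
    qed (auto simp: U_def)
    have subU: "linear_subspace (U n)" for n
    proof -
      interpret Jn: ideal "J n" Q using J by blast
      have N: "linear_subspace {p :: 'k mpoly. supp p \<subseteq> N}" by (rule linear_subspace_supp)
      have "rs 0 \<in> J n" using rs_eq_zero[of 0] I_zero I_carrier Jn.zero_closed by metis
      moreover have "rs (p + q) \<in> J n" if "p \<in> U n" "q \<in> U n" for p q
        using that rs_add[OF sN sN, of p q] Jn.a_closed by (simp add: U_def)
      moreover have "rs (Const c * p) \<in> J n" if "p \<in> U n" for p c
        using that rs_mult[OF Const_carrier sN, of p c] Jn.I_l_closed[of "rs p" "rs (Const c)"]
          rs_closed[OF Const_carrier] by (simp add: U_def)
      ultimately show ?thesis using N unfolding linear_subspace_def U_def by blast
    qed
    have decU: "U n \<subseteq> U m" if "m \<le> n" for m n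
    proof -
      have "J n \<subseteq> J m" using that by (rule lift_Suc_antimono_le[rotated]) (use J in blast)
      then show ?thesis unfolding U_def by blast
    qed
    have finL: "finite (leads (U n))" for n
      using finite_subset[OF leads_subset[of "U n" N] fin] unfolding U_def by blast
    obtain n0 where n0: "\<And>n. card (leads (U n0)) \<le> card (leads (U n))"
      using ex_has_least_nat[of "\<lambda>_. True" 0 "\<lambda>n. card (leads (U n))"] by blast
    have "U n = U n0" if "n \<ge> n0" for n
    proof (rule subspace_eq_if_leads_eq[OF fin subU subU decU[OF that]])
      show "supp p \<subseteq> N" if "p \<in> U n0" for p using that by (simp add: U_def)
      show "leads (U n) = leads (U n0)"
        by (rule card_seteq[OF finL leads_mono[OF decU[OF that]] n0])
    qed
    then show ?thesis unfolding JU by metis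
  qed
  then show ?thesis using Q.ring_axioms unfolding artinian_ring_def I_def by blast
qed

lemma standard_monomial_ideal:
  fixes e :: nat
  assumes "e \<ge> 1" "N \<inter> monoms e \<noteq> {}" "\<And>d. d > e \<Longrightarrow> N \<inter> monoms d = {}"
  shows "standard_graded_artinian r (monomial_ideal r N :: 'k::field_char_0 mpoly set)"
    and "top_degree r (monomial_ideal r N :: 'k mpoly set) = e"
proof -
  define I where "I = (monomial_ideal r N :: 'k mpoly set)"
  interpret proper_poly_ideal r I unfolding I_def by (rule proper_monomial_ideal)
  have std: "std_monoms r I d = N \<inter> monoms d" for d
    unfolding I_def by (rule std_monoms_monomial_ideal)
  have e: "top_degree r I = e"
    by (rule top_degreeI) (use assms in \<open>auto simp: forms_subset_iff_std std\<close>)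
  have "hom_component d p \<in> I" if p: "p \<in> I" for d p
  proof -
    have "supp (hom_component d p) \<subseteq> supp p"
      by (auto simp: in_keys_iff cf_hom_component split: if_splits)
    then show ?thesis using p unfolding I_def monomial_ideal_def poly_carrier_def by blast
  qed
  then have hom: "homogeneous_ideal r I" using idl by (simp add: homogeneous_ideal_def)
  have lin: "\<forall>f\<in>I \<inter> forms r 1. f = 0"
  proof
    fix f assume f: "f \<in> I \<inter> forms r 1"
    have "monoms_in r 1 \<subseteq> N"
    proof
      fix m assume m: "m \<in> monoms_in r 1"
      then obtain j where j: "m = X j" using monoms_in_monoms[of r 1] monoms_1 by blast
      then have "j < r" using m by (simp add: monoms_in_def)
      then show "m \<in> N" using j variables by simp
    qed
    moreover have "supp f \<subseteq> monoms_in r 1" using f forms_iff by blast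
    moreover have "supp f \<inter> N = {}" using f unfolding I_def monomial_ideal_def by blast
    ultimately have "supp f = {}" by blast
    then show "f = 0" by (simp add: keys_eq_empty)
  qed
  show "standard_graded_artinian r (monomial_ideal r N :: 'k mpoly set)"
    using hom proper lin artinian_monomial_ideal e assms(1)
    unfolding standard_graded_artinian_def I_def by blast
  show "top_degree r (monomial_ideal r N :: 'k mpoly set) = e" using e unfolding I_def .
qed

end

section \<open>Minimal shadows and the numerical conditions\<close>

text \<open>
  The least size of the shadow of \<open>n\<close> monomials of degree \<open>d\<close>, for \<open>d > 0\<close>: by Macaulay's theorem initial
  segments realize it, and an initial segment is determined by its degree and its size.\<close>

definition min_shadow :: "nat \<Rightarrow> nat \<Rightarrow> nat" where
  "min_shadow d n = card (shadow (SOME C. initial d C \<and> card C = n))"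

lemma initial_unique:
  assumes "initial d C" "initial d D" "card C = card D" shows "C = D"
  using initial_subset[OF assms(1,2)] initial_subset[OF assms(2,1)] assms(3) by simp

lemma min_shadow_eq: assumes "initial d C" shows "min_shadow d (card C) = card (shadow C)"
proof -
  let ?D = "SOME D. initial d D \<and> card D = card C"
  have "initial d ?D \<and> card ?D = card C"
    by (rule someI[of _ C]) (use assms in simp)
  then have "?D = C" using initial_unique assms by blast
  then show ?thesis by (simp add: min_shadow_def)
qed

lemma min_shadow_le:
  assumes "d > 0" "finite N" "N \<subseteq> monoms d" "n \<le> card N" shows "min_shadow d n \<le> card (shadow N)"
proof -
  obtain C where C: "initial d C" "card C = n" using exists_initial[OF assms(1)] by blast
  then show ?thesis using shadow_initial_minimal[OF C(1) assms(2,3)] min_shadow_eq[OF C(1)] assms(4) by simp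
qed

lemma min_shadow_mono:
  assumes "d > 0" "n \<le> n'" shows "min_shadow d n \<le> min_shadow d n'"
proof -
  obtain C where C: "initial d C" "card C = n'" using exists_initial[OF assms(1)] by blast
  then have "min_shadow d n \<le> card (shadow C)"
    using min_shadow_le[OF assms(1), of C n] assms(2) by (simp add: initial_def)
  then show ?thesis using min_shadow_eq[OF C(1)] C(2) by simp
qed

lemma shadow_nonempty:
  assumes "N \<subseteq> monoms d" "d > 0" "N \<noteq> {}" shows "shadow N \<noteq> {}"
proof -
  obtain m where m: "m \<in> N" using assms by blast
  then have "monom_degree m = d" using assms(1) by (auto simp: monoms_def)
  then have "m \<noteq> 0" using assms(2) by (intro notI) simp
  then show ?thesis using monom_split m shadowI by blast
qed

lemma min_shadow_pos:
  assumes "d > 0" "n > 0" shows "min_shadow d n > 0"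
proof -
  obtain C where C: "initial d C" "card C = n" using exists_initial[OF assms(1)] by blast
  then have "C \<noteq> {}" using assms(2) by auto
  then have "shadow C \<noteq> {}" using shadow_nonempty[of C d] C assms(1) by (simp add: initial_def)
  then show ?thesis
    using min_shadow_eq[OF C(1)] C finite_shadow[OF initial_finite[OF C(1)]] by (simp add: card_gt_0_iff)
qed

text \<open>
  The correction term \<open>f\<^bsub>i+1\<^esub> (h\<^bsub>i+1\<^esub>)\<close>; the default value 0 in the last position makes the condition there
  read \<open>s\<^sub>e \<le> h\<^sub>e\<close>.\<close>

definition next_shadow :: "nat list \<Rightarrow> nat \<Rightarrow> nat" where
  "next_shadow h i = (if Suc i < length h then min_shadow (Suc i) (h ! Suc i) else 0)"

lemma algebra_bounds:
  assumes "standard_graded_artinian r I"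
  defines "h \<equiv> h_vector r I" and "s \<equiv> socle_vector r I"
  shows "length h \<ge> 2" "length s = length h" "h ! 0 = 1" "last h > 0" "last s = last h"
    "i < length h \<Longrightarrow> s ! i + next_shadow h i \<le> h ! i"
proof -
  interpret proper_poly_ideal r I by (rule standard_proper[OF assms(1)])
  obtain M where M: "\<And>d. d \<ge> M \<Longrightarrow> forms r d \<subseteq> I" using eventually_forms_subset[OF assms(1)] by blast
  define e where "e = top_degree r I"
  have e: "\<not> forms r e \<subseteq> I" "forms r (Suc e) \<subseteq> I" "e \<ge> 1"
    using top_degree_props[OF M] assms(1) unfolding e_def standard_graded_artinian_def by blast+
  have len: "length h = Suc e" "length s = Suc e"
    by (simp_all add: h_def s_def h_vector_def socle_vector_def e_def)
  have h: "h ! i = card (std_monoms r I i)" if "i \<le> e" for i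
    using that by (simp add: h_def h_vector_def alg_dim_graded_piece nth_append flip: e_def del: upt_Suc)
  have s: "s ! i = alg_dim r I (socle r I \<inter> graded_piece r I i)" if "i \<le> e" for i
    using that by (simp add: s_def socle_vector_def flip: e_def del: upt_Suc)
  have last: "last h = h ! e" "last s = s ! e" using len by (metis diff_Suc_1 last_conv_nth length_0_conv nat.distinct(1))+
  show "length h \<ge> 2" "length s = length h" using len e by simp_all
  show "h ! 0 = 1" by (simp add: h std_monoms_0)
  show "last h > 0"
    using e(1) finite_std_monoms[of r I e] by (simp add: last h card_gt_0_iff forms_subset_iff_std)
  show "last s = last h"
    unfolding last by (simp add: s h socle_eq_graded_piece[OF e(2)] alg_dim_graded_piece)
  assume i: "i < length h"
  show "s ! i + next_shadow h i \<le> h ! i"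
  proof (cases "i < e")
    case True
    have "min_shadow (Suc i) (h ! Suc i) \<le> card (shadow (std_monoms r I (Suc i)))"
      by (rule min_shadow_le[OF _ finite_std_monoms std_monoms_monoms]) (use True h in simp_all)
    then show ?thesis
      using True socle_plus_shadow_le[of i] h[of i] s[of i]
      by (simp add: next_shadow_def len alg_dim_graded_piece)
  next
    case False
    then have "i = e" using i len by simp
    then show ?thesis using \<open>last s = last h\<close> by (simp add: last next_shadow_def len)
  qed
qed

text \<open>
  Initial segments \<open>L i\<close> of size \<open>h ! i\<close> are closed under division because the shadow of \<open>L (Suc i)\<close>
  is an initial segment of size \<open>next_shadow h i\<close>, at most that of \<open>L i\<close>. The number of variables has to
  be \<open>h ! 1\<close>, so that no variable vanishes in the quotient.\<close>

lemma realize: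
  fixes h s :: "nat list"
  assumes len: "length h \<ge> 2" "length s = length h" and h0: "h ! 0 = 1" and last: "last h > 0"
    and eq: "\<And>i. i < length h \<Longrightarrow> h ! i = s ! i + next_shadow h i"
  shows "\<exists>r (I :: 'k::field_char_0 mpoly set).
    standard_graded_artinian r I \<and> h_vector r I = h \<and> socle_vector r I = s"
proof -
  define e where "e = length h - 1"
  have e: "e \<ge> 1" "length h = Suc e" using len by (simp_all add: e_def)
  have le: "h ! e > 0" using last e by (metis diff_Suc_1 last_conv_nth length_0_conv nat.distinct(1))
  have "\<exists>C. (i = 0 \<longrightarrow> C = {0}) \<and> (i > 0 \<longrightarrow> initial i C) \<and> card C = (if i \<le> e then h ! i else 0)" for i
    using exists_initial[of i] h0 by (cases "i = 0") auto
  then obtain L where L0: "L 0 = {0}" and L: "\<And>i. i > 0 \<Longrightarrow> initial i (L i)"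
    and card: "\<And>i. card (L i) = (if i \<le> e then h ! i else 0)"
    by metis
  have finL: "finite (L i)" for i using L0 L[of i] by (cases "i = 0") (auto simp: initial_def)
  have LM: "L i \<subseteq> monoms i" for i
    using L0 L[of i] by (cases "i = 0") (auto simp: initial_def monoms_def)
  have empty: "L i = {}" if "i > e" for i using card[of i] that finL[of i] by simp
  have sh_card: "card (shadow (L (Suc i))) = next_shadow h i" for i
  proof (cases "i < e")
    case True
    then show ?thesis using min_shadow_eq[OF L[of "Suc i"]] card[of "Suc i"] by (simp add: next_shadow_def e)
  next
    case False
    then show ?thesis using empty[of "Suc i"] by (simp add: next_shadow_def e shadow_def)
  qed
  have sh: "shadow (L (Suc i)) \<subseteq> L i" for i
  proof (cases "i = 0")
    case True
    then show ?thesis using shadow_monoms[OF LM[of "Suc i"]] L0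
      by (auto simp: monoms_def monom_degree_eq_0_iff)
  next
    case i: False
    show ?thesis
    proof (cases "i \<le> e")
      case True
      show ?thesis
      proof (rule initial_subset[OF initial_shadow[OF L] L])
        show "card (shadow (L (Suc i))) \<le> card (L i)"
          using eq[of i] True by (simp add: sh_card card e)
      qed (use i in simp_all)
    next
      case False
      then show ?thesis using empty[of "Suc i"] by (simp add: shadow_def)
    qed
  qed
  define N where "N = (\<Union>i\<le>e. L i)"
  have Nd: "N \<inter> monoms d = L d" for d
  proof
    show "N \<inter> monoms d \<subseteq> L d" using LM unfolding N_def monoms_def by auto
    show "L d \<subseteq> N \<inter> monoms d" using LM[of d] empty[of d] unfolding N_def by (cases "d \<le> e") auto
  qed
  have memN: "m \<in> N \<longleftrightarrow> m \<in> L (monom_degree m)" for m using Nd[of "monom_degree m"] by (auto simp: monoms_def)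
  define r where "r = h ! 1"
  have "initial 1 (X ` {..<r})"
    unfolding initial_def
  proof (intro conjI ballI impI)
    fix m n assume mn: "m \<in> X ` {..<r}" "n \<in> monoms 1" "n \<prec> m"
    then obtain i k where ik: "m = X i" "i < r" "n = X k" using monoms_1 by auto
    have "\<not> i \<le> k" using mn(3) colex_X[of i k 0] colex_asym colex_irrefl ik by (cases "i = k") auto
    then show "n \<in> X ` {..<r}" using ik by auto
  qed (auto simp: monoms_def)
  moreover have "card (X ` {..<r}) = card (L 1)"
  proof -
    have "inj_on X {..<r}" using X_eq_iff by (intro inj_onI) blast
    then show ?thesis using e(1) card[of 1] card_image[of X "{..<r}"] by (simp add: r_def)
  qed
  ultimately have L1: "L 1 = X ` {..<r}"
    using initial_unique[OF L[of 1]] by simp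
  interpret order_ideal r N
  proof
    show "finite N" unfolding N_def using finL by blast
    show "0 \<in> N" using memN[of 0] L0 by simp
    show "m \<in> N" if "m + X j \<in> N" for m j
    proof -
      have "m + X j \<in> L (Suc (monom_degree m))" using that memN[of "m + X j"] by (simp add: monom_degree_add)
      then have "m \<in> shadow (L (Suc (monom_degree m)))" by (rule shadowI)
      then show ?thesis using sh memN by blast
    qed
    show "X j \<in> N \<longleftrightarrow> j < r" for j
    proof -
      have "X j \<in> N \<longleftrightarrow> X j \<in> X ` {..<r}" using memN[of "X j"] L1 by simp
      also have "\<dots> \<longleftrightarrow> j < r" by (simp only: image_iff X_eq_iff) simp
      finally show ?thesis .
    qed
  qed
  define I where "I = (monomial_ideal r N :: 'k mpoly set)"
  interpret proper_poly_ideal r I unfolding I_def by (rule proper_monomial_ideal)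
  have ne: "N \<inter> monoms e \<noteq> {}" unfolding Nd using card[of e] le by auto
  have zr: "N \<inter> monoms d = {}" if "d > e" for d unfolding Nd using empty[OF that] .
  have std: "standard_graded_artinian r I" and top: "top_degree r I = e"
    unfolding I_def using standard_monomial_ideal[OF e(1) ne zr] by blast+
  have "h_vector r I = h"
  proof (rule nth_equalityI)
    show "length (h_vector r I) = length h" by (simp add: h_vector_def top e)
    fix i assume "i < length (h_vector r I)"
    then have i: "i \<le> e" by (simp add: h_vector_def top)
    then have "h_vector r I ! i = alg_dim r I (graded_piece r I i)"
      by (simp add: h_vector_def top del: upt_Suc)
    also have "\<dots> = card (std_monoms r I i)" by (rule alg_dim_graded_piece)
    also have "std_monoms r I i = L i" unfolding I_def std_monoms_monomial_ideal Nd ..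
    finally show "h_vector r I ! i = h ! i" using card[of i] i by simp
  qed
  moreover have "socle_vector r I = s"
  proof (rule nth_equalityI)
    show "length (socle_vector r I) = length s" by (simp add: socle_vector_def top e len)
    fix i assume "i < length (socle_vector r I)"
    then have i: "i \<le> e" by (simp add: socle_vector_def top)
    then have "socle_vector r I ! i = alg_dim r I (socle r I \<inter> graded_piece r I i)"
      by (simp add: socle_vector_def top del: upt_Suc)
    also have "\<dots> = card (L i - shadow N)"
      unfolding I_def alg_dim_socle_monomial_ideal Nd ..
    also have "L i - shadow N = L i - shadow (L (Suc i))"
    proof -
      have "m \<in> shadow N \<longleftrightarrow> m \<in> shadow (L (Suc i))" if "m \<in> L i" for m
      proof -
        have "monom_degree m = i" using that LM by (auto simp: monoms_def)
        then have "m + X j \<in> N \<longleftrightarrow> m + X j \<in> L (Suc i)" for j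
          using memN[of "m + X j"] by (simp add: monom_degree_add)
        then show ?thesis by (simp add: shadow_def)
      qed
      then show ?thesis by blast
    qed
    also have "card \<dots> = h ! i - next_shadow h i"
      using card_Diff_subset[OF finite_shadow[OF finL] sh[of i]] card[of i] i sh_card[of i] by simp
    also have "\<dots> = s ! i" using eq[of i] i e by simp
    finally show "socle_vector r I ! i = s ! i" .
  qed
  ultimately show ?thesis using std by blast
qed

section \<open>The minimum h-vector of a socle-vector\<close>

text \<open>
  Solves \<open>h\<^sub>i = s\<^sub>i + f\<^bsub>i+1\<^esub> (h\<^bsub>i+1\<^esub>)\<close> from the last entry backwards. The list is a tail of a socle-vector
  and \<open>d\<close> is the degree of its first entry.\<close>

primrec least_h :: "nat \<Rightarrow> nat list \<Rightarrow> nat list" where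
  "least_h d [] = []"
| "least_h d (a # s) =
    (a + (if s = [] then 0 else min_shadow (Suc d) (hd (least_h (Suc d) s)))) # least_h (Suc d) s"

lemma length_least_h [simp]: "length (least_h d s) = length s"
  by (induction s arbitrary: d) auto

lemma nth_least_h:
  "i < length s \<Longrightarrow> least_h d s ! i =
    s ! i + (if Suc i < length s then min_shadow (Suc (d + i)) (least_h d s ! Suc i) else 0)"
proof (induction s arbitrary: d i)
  case (Cons a s)
  show ?case
  proof (cases i)
    case 0
    have "least_h (Suc d) s \<noteq> []" if "s \<noteq> []" using that by (metis length_0_conv length_least_h)
    then show ?thesis using 0 by (auto simp: hd_conv_nth)
  next
    case (Suc j)
    then show ?thesis using Cons.IH[of j "Suc d"] Cons.prems by simp
  qed
qed simp

lemma least_h_eq: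
  assumes "i < length s" shows "least_h 0 s ! i = s ! i + next_shadow (least_h 0 s) i"
  using nth_least_h[OF assms, of 0] by (simp add: next_shadow_def)

lemma least_h_le:
  assumes len: "length h = length s" and le: "\<And>i. i < length s \<Longrightarrow> s ! i + next_shadow h i \<le> h ! i"
    and i: "i < length s"
  shows "least_h 0 s ! i \<le> h ! i"
  using i
proof (induction "length s - i" arbitrary: i rule: less_induct)
  case less
  have "next_shadow (least_h 0 s) i \<le> next_shadow h i"
  proof (cases "Suc i < length s")
    case True
    then have "least_h 0 s ! Suc i \<le> h ! Suc i" by (intro less.hyps) auto
    then show ?thesis using min_shadow_mono[of "Suc i"] len by (simp add: next_shadow_def)
  qed (simp add: next_shadow_def len)
  then show ?case using least_h_eq[OF less.prems] le[OF less.prems] by linarith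
qed

lemma least_h_unique:
  assumes len: "length h = length s" and eq: "\<And>i. i < length s \<Longrightarrow> h ! i = s ! i + next_shadow h i"
  shows "least_h 0 s = h"
proof -
  have "least_h 0 s ! i = h ! i" if "i < length s" for i
    using that
  proof (induction "length s - i" arbitrary: i rule: less_induct)
    case less
    have "next_shadow (least_h 0 s) i = next_shadow h i"
    proof (cases "Suc i < length s")
      case True
      then have "least_h 0 s ! Suc i = h ! Suc i" by (intro less.hyps) auto
      then show ?thesis using len by (simp add: next_shadow_def)
    qed (simp add: next_shadow_def len)
    then show ?case using least_h_eq[OF less.prems] eq[OF less.prems] by linarith
  qed
  then show ?thesis using len by (intro nth_equalityI) auto
qed

lemma least_h_inj: assumes "least_h 0 s = least_h 0 t" shows "s = t"
proof (rule nth_equalityI)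
  show len: "length s = length t" using arg_cong[OF assms, of length] by simp
  fix i assume "i < length s"
  then show "s ! i = t ! i" using least_h_eq[of i s] least_h_eq[of i t] assms len by simp
qed

text \<open>
  Minimality is \<open>least_h_le\<close> applied to any algebra with socle-vector \<open>s\<close>. To realize \<open>least_h 0 s\<close> its
  first entry has to be 1: it is at most 1 by minimality, and positive because \<open>s\<^sub>e\<close> is positive and
  positivity propagates down through the shadows.\<close>

lemma is_min_least_h:
  assumes "s \<in> socle_vectors TYPE('k::field_char_0)"
  shows "is_min_h_vector TYPE('k) s (least_h 0 s)"
proof -
  obtain r and I :: "'k mpoly set" where std: "standard_graded_artinian r I" and s: "s = socle_vector r I"
    using assms by (auto simp: socle_vectors_def)
  let ?H = "least_h 0 s"
  have lower: "?H ! i \<le> h_vector r I ! i"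
    if "standard_graded_artinian r I" "socle_vector r I = s" "i < length s" for i r and I :: "'k mpoly set"
    by (rule least_h_le) (use algebra_bounds[OF that(1)] that in auto)
  note b = algebra_bounds[OF std, folded s]
  have len: "length s \<ge> 2" using b(1,2) by simp
  define e where "e = length s - 1"
  have e: "length s = Suc e" using len by (simp add: e_def)
  have se: "s ! e > 0" using b(4,5) e by (metis diff_Suc_1 last_conv_nth length_0_conv nat.distinct(1))
  have He: "?H ! e = s ! e" using least_h_eq[of e s] e by (simp add: next_shadow_def)
  have pos: "?H ! i > 0" if "i \<le> e" for i
    using that
  proof (induction rule: inc_induct)
    case base
    then show ?case using se He by simp
  next
    case (step n)
    then have "min_shadow (Suc n) (?H ! Suc n) > 0" by (intro min_shadow_pos) auto
    then show ?case using least_h_eq[of n s] step e by (simp add: next_shadow_def)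
  qed
  have "\<exists>r' (I' :: 'k mpoly set). standard_graded_artinian r' I' \<and> h_vector r' I' = ?H \<and> socle_vector r' I' = s"
  proof (rule realize)
    have "0 < length s" using len by linarith
    then show "?H ! 0 = 1" using pos[of 0] lower[OF std s[symmetric], of 0] b(3) by linarith
    show "last ?H > 0" using pos[of e] e by (metis diff_Suc_1 last_conv_nth length_0_conv length_least_h nat.distinct(1) order_refl)
  qed (use len least_h_eq in auto)
  then obtain r' and I' :: "'k mpoly set" where
    "standard_graded_artinian r' I'" "h_vector r' I' = ?H" "socle_vector r' I' = s" by blast
  then have "?H \<in> h_vectors_with_socle TYPE('k) s"
    unfolding h_vectors_with_socle_def mem_Collect_eq
    by (intro exI[of _ r'] exI[of _ I']) simp
  moreover have "list_all2 (\<le>) ?H h'" if h': "h' \<in> h_vectors_with_socle TYPE('k) s" for h'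
  proof -
    obtain r and I :: "'k mpoly set" where rI: "standard_graded_artinian r I" "socle_vector r I = s" "h' = h_vector r I"
      using h' by (auto simp: h_vectors_with_socle_def)
    have "length h' = length s" using algebra_bounds(2)[OF rI(1)] rI by simp
    then show ?thesis using lower[OF rI(1,2)] rI(3) by (simp add: list_all2_conv_all_nth)
  qed
  ultimately show ?thesis by (simp add: is_min_h_vector_def)
qed

lemma is_min_h_vector_unique:
  assumes "is_min_h_vector T s h" "is_min_h_vector T s h'" shows "h = h'"
proof -
  have le: "list_all2 (\<le>) h h'" "list_all2 (\<le>) h' h"
    using assms unfolding is_min_h_vector_def by blast+
  show ?thesis
  proof (rule nth_equalityI)
    show "length h = length h'" using le(1) by (rule list_all2_lengthD)
    show "h ! i = h' ! i" if "i < length h" for i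
      using list_all2_nthD[OF le(1) that] list_all2_nthD2[OF le(2) that] by simp
  qed
qed

theorem mainTheorem2:
  shows "(\<forall>s \<in> socle_vectors TYPE('k::field_char_0). \<exists>!h. is_min_h_vector TYPE('k) s h) \<and>
    bij_betw (min_h_vector TYPE('k)) (socle_vectors TYPE('k)) (h_vectors TYPE('k))"
proof
  show ex1: "\<forall>s \<in> socle_vectors TYPE('k). \<exists>!h. is_min_h_vector TYPE('k) s h"
    using is_min_least_h is_min_h_vector_unique by blast
  have min: "min_h_vector TYPE('k) s = least_h 0 s" if "s \<in> socle_vectors TYPE('k)" for s
    unfolding min_h_vector_def
    using ex1[rule_format, OF that] is_min_least_h[OF that] by (rule the1_equality)
  show "bij_betw (min_h_vector TYPE('k)) (socle_vectors TYPE('k)) (h_vectors TYPE('k))"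
    unfolding bij_betw_def
  proof (intro conjI equalityI subsetI)
    show "inj_on (min_h_vector TYPE('k)) (socle_vectors TYPE('k))"
      using least_h_inj by (auto intro!: inj_onI simp: min)
    fix h assume "h \<in> min_h_vector TYPE('k) ` socle_vectors TYPE('k)"
    then obtain s where s: "s \<in> socle_vectors TYPE('k)" "h = least_h 0 s" using min by auto
    have "h \<in> h_vectors_with_socle TYPE('k) s"
      using is_min_least_h[OF s(1)] s(2) by (simp add: is_min_h_vector_def)
    then show "h \<in> h_vectors TYPE('k)" unfolding h_vectors_with_socle_def h_vectors_def by blast
  next
    fix h assume "h \<in> h_vectors TYPE('k)"
    then obtain r and I :: "'k mpoly set" where rI: "standard_graded_artinian r I" "h = h_vector r I"
      by (auto simp: h_vectors_def)
    note b = algebra_bounds[OF rI(1), folded rI(2)]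
    define s where "s = map (\<lambda>i. h ! i - next_shadow h i) [0..<length h]"
    have len: "length s = length h" by (simp add: s_def)
    have eq: "h ! i = s ! i + next_shadow h i" if "i < length h" for i
      using b(6)[OF that] that by (simp add: s_def)
    have "s \<in> socle_vectors TYPE('k)"
      using realize[OF b(1) len b(3,4) eq] unfolding socle_vectors_def by blast
    moreover have "least_h 0 s = h" by (rule least_h_unique) (use len eq in auto)
    ultimately show "h \<in> min_h_vector TYPE('k) ` socle_vectors TYPE('k)" using min by force
  qed
qed

end
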